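(* Let $(V,\{\nu_n\})$ be an $L^\infty$-MOS, let $S\subseteq V$ be a self-adjoint subspace endowed with the restricted order gauges $\nu_n|_{M_n(S)_{sa}}$, and let $H$ be a Hilbert space, with $B(H)$ endowed with the order gauges $d_{n,B(H)}$. If $\phi:S\to B(H)$ is completely gauge-contractive, then there exists a completely gauge-contractive map $\tilde\phi:V\to B(H)$ extending $\phi$.
   Context: An $L^\infty$-MOS is a complex $*$-vector space $V$ ($M_n(V)$ with $(x_{ij})^*=(x_{ji}^* )$, self-adjoint part $M_n(V)_{sa}$) with proper gauges $\nu_n:M_n(V)_{sa}\to[0,\infty)$ (subadditive, positively homogeneous, $\nu_n(A)=\nu_n(-A)=0\Rightarrow A=0$) such that $\nu_k(X^*AX)\le\|X\|^2\nu_n(A)$ for scalar $X\in M_{n,k}$ and $\nu_{n+k}(A\oplus B)=\max\{\nu_n(A),\nu_k(B)\}$. For $T\in M_n(B(H))_{sa}\cong B(H^n)_{sa}$, $d_{n,B(H)}(T)=\inf\{\|T+P\|:P\ge0\}=\inf\{t>0:T\le tI\}$. A linear map $\phi$ is completely gauge-contractive if $\phi(x^* )=\phi(x)^*$ and $\omega_n(\phi^{(n)}(A))\le\nu_n(A)$ for all $n$ and self-adjoint $A\in M_n$ of the domain, where $\omega_n$ are the order gauges of the codomain. *)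

theory Defs
  imports Complex_Main
begin

definition star_vector_space ::
  "(complex \<Rightarrow> 'v::ab_group_add \<Rightarrow> 'v) \<Rightarrow> ('v \<Rightarrow> 'v) \<Rightarrow> bool" where
  "star_vector_space sc st \<longleftrightarrow> module sc \<and>
     (\<forall>x y. st (x + y) = st x + st y) \<and>
     (\<forall>c x. st (sc c x) = sc (cnj c) (st x)) \<and>
     (\<forall>x. st (st x) = x)"

definition in_Mn :: "nat \<Rightarrow> (nat \<Rightarrow> nat \<Rightarrow> 'v::zero) \<Rightarrow> bool" where
  "in_Mn n A \<longleftrightarrow> (\<forall>i j. (n \<le> i \<or> n \<le> j) \<longrightarrow> A i j = 0)"

definition mat_selfadj :: "('v \<Rightarrow> 'v) \<Rightarrow> nat \<Rightarrow> (nat \<Rightarrow> nat \<Rightarrow> 'v) \<Rightarrow> bool" where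
  "mat_selfadj st n A \<longleftrightarrow> (\<forall>i<n. \<forall>j<n. A j i = st (A i j))"

definition Msa :: "('v::zero \<Rightarrow> 'v) \<Rightarrow> nat \<Rightarrow> (nat \<Rightarrow> nat \<Rightarrow> 'v) set" where
  "Msa st n = {A. in_Mn n A \<and> mat_selfadj st n A}"

definition compress ::
  "(complex \<Rightarrow> 'v::ab_group_add \<Rightarrow> 'v) \<Rightarrow> nat \<Rightarrow> nat \<Rightarrow> (nat \<Rightarrow> nat \<Rightarrow> complex)
     \<Rightarrow> (nat \<Rightarrow> nat \<Rightarrow> 'v) \<Rightarrow> (nat \<Rightarrow> nat \<Rightarrow> 'v)" where
  "compress sc n k X A = (\<lambda>p q. if p < k \<and> q < k then
       (\<Sum>i<n. \<Sum>j<n. sc (cnj (X i p) * X j q) (A i j)) else 0)"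

definition cmat_norm :: "nat \<Rightarrow> nat \<Rightarrow> (nat \<Rightarrow> nat \<Rightarrow> complex) \<Rightarrow> real" where
  "cmat_norm n k X = Sup {sqrt (\<Sum>i<n. (cmod (\<Sum>j<k. X i j * \<xi> j))\<^sup>2) | \<xi>.
                            (\<Sum>j<k. (cmod (\<xi> j))\<^sup>2) \<le> 1}"

definition dsum :: "nat \<Rightarrow> (nat \<Rightarrow> nat \<Rightarrow> 'v::zero) \<Rightarrow> (nat \<Rightarrow> nat \<Rightarrow> 'v) \<Rightarrow> (nat \<Rightarrow> nat \<Rightarrow> 'v)" where
  "dsum n A B = (\<lambda>i j. if i < n \<and> j < n then A i j
                       else if n \<le> i \<and> n \<le> j then B (i - n) (j - n) else 0)"

definition Linf_MOS ::
  "(complex \<Rightarrow> 'v::ab_group_add \<Rightarrow> 'v) \<Rightarrow> ('v \<Rightarrow> 'v) \<Rightarrow> (nat \<Rightarrow> (nat \<Rightarrow> nat \<Rightarrow> 'v) \<Rightarrow> real) \<Rightarrow> bool" where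
  "Linf_MOS sc st \<nu> \<longleftrightarrow> star_vector_space sc st \<and>
     (\<forall>n\<ge>1. \<forall>A\<in>Msa st n. 0 \<le> \<nu> n A) \<and>
     (\<forall>n\<ge>1. \<forall>A\<in>Msa st n. \<forall>B\<in>Msa st n. \<nu> n (\<lambda>i j. A i j + B i j) \<le> \<nu> n A + \<nu> n B) \<and>
     (\<forall>n\<ge>1. \<forall>A\<in>Msa st n. \<forall>t::real. 0 < t \<longrightarrow> \<nu> n (\<lambda>i j. sc (complex_of_real t) (A i j)) = t * \<nu> n A) \<and>
     (\<forall>n\<ge>1. \<forall>A\<in>Msa st n. \<nu> n A = 0 \<and> \<nu> n (\<lambda>i j. - A i j) = 0 \<longrightarrow> A = (\<lambda>i j. 0)) \<and>
     (\<forall>n\<ge>1. \<forall>k\<ge>1. \<forall>A\<in>Msa st n. \<forall>X. \<nu> k (compress sc n k X A) \<le> (cmat_norm n k X)\<^sup>2 * \<nu> n A) \<and>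
     (\<forall>n\<ge>1. \<forall>k\<ge>1. \<forall>A\<in>Msa st n. \<forall>B\<in>Msa st k. \<nu> (n + k) (dsum n A B) = max (\<nu> n A) (\<nu> k B))"

definition selfadjoint_subspace ::
  "(complex \<Rightarrow> 'v::ab_group_add \<Rightarrow> 'v) \<Rightarrow> ('v \<Rightarrow> 'v) \<Rightarrow> 'v set \<Rightarrow> bool" where
  "selfadjoint_subspace sc st S \<longleftrightarrow> 0 \<in> S \<and> (\<forall>x\<in>S. \<forall>y\<in>S. x + y \<in> S) \<and>
     (\<forall>c. \<forall>x\<in>S. sc c x \<in> S) \<and> (\<forall>x\<in>S. st x \<in> S)"

definition hnorm :: "('h \<Rightarrow> 'h \<Rightarrow> complex) \<Rightarrow> 'h \<Rightarrow> real" where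
  "hnorm ip x = sqrt (Re (ip x x))"

definition hilbert_space ::
  "(complex \<Rightarrow> 'h::ab_group_add \<Rightarrow> 'h) \<Rightarrow> ('h \<Rightarrow> 'h \<Rightarrow> complex) \<Rightarrow> bool" where
  "hilbert_space sc ip \<longleftrightarrow> module sc \<and>
     (\<forall>x y z. ip (x + y) z = ip x z + ip y z) \<and>
     (\<forall>c x y. ip (sc c x) y = c * ip x y) \<and>
     (\<forall>x y. ip y x = cnj (ip x y)) \<and>
     (\<forall>x. 0 \<le> Re (ip x x)) \<and>
     (\<forall>x. ip x x = 0 \<longrightarrow> x = 0) \<and>
     (\<forall>u::nat \<Rightarrow> 'h. (\<forall>e>0. \<exists>N. \<forall>m\<ge>N. \<forall>n\<ge>N. hnorm ip (u m - u n) < e) \<longrightarrow>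
        (\<exists>l. \<forall>e>0. \<exists>N. \<forall>n\<ge>N. hnorm ip (u n - l) < e))"

definition bounded_op ::
  "(complex \<Rightarrow> 'h::ab_group_add \<Rightarrow> 'h) \<Rightarrow> ('h \<Rightarrow> 'h \<Rightarrow> complex) \<Rightarrow> ('h \<Rightarrow> 'h) \<Rightarrow> bool" where
  "bounded_op sc ip T \<longleftrightarrow> (\<forall>x y. T (x + y) = T x + T y) \<and> (\<forall>c x. T (sc c x) = sc c (T x)) \<and>
     (\<exists>K. \<forall>x. hnorm ip (T x) \<le> K * hnorm ip x)"

text \<open>Order gauge \<open>d_{n,B(H)}(T) = inf {t > 0. T \<le> t I}\<close>, where T is an n x n matrix of
  operators acting on \<open>H^n\<close> and \<open>T \<le> t I\<close> means \<open><T\<xi>,\<xi>> \<le> t <\<xi>,\<xi>>\<close> for all \<open>\<xi> \<in> H^n\<close>.\<close>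
definition dgauge :: "('h \<Rightarrow> 'h \<Rightarrow> complex) \<Rightarrow> nat \<Rightarrow> (nat \<Rightarrow> nat \<Rightarrow> 'h \<Rightarrow> 'h) \<Rightarrow> real" where
  "dgauge ip n T = Inf {t. 0 < t \<and> (\<forall>\<xi>::nat \<Rightarrow> 'h.
       Re (\<Sum>i<n. \<Sum>j<n. ip (T i j (\<xi> j)) (\<xi> i)) \<le> t * (\<Sum>i<n. Re (ip (\<xi> i) (\<xi> i))))}"

definition linear_into_BH ::
  "(complex \<Rightarrow> 'v::ab_group_add \<Rightarrow> 'v) \<Rightarrow> 'v set \<Rightarrow> (complex \<Rightarrow> 'h::ab_group_add \<Rightarrow> 'h)
     \<Rightarrow> ('h \<Rightarrow> 'h \<Rightarrow> complex) \<Rightarrow> ('v \<Rightarrow> 'h \<Rightarrow> 'h) \<Rightarrow> bool" where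
  "linear_into_BH scV S scH ip \<phi> \<longleftrightarrow>
     (\<forall>x\<in>S. bounded_op scH ip (\<phi> x)) \<and>
     (\<forall>x\<in>S. \<forall>y\<in>S. \<phi> (x + y) = (\<lambda>h. \<phi> x h + \<phi> y h)) \<and>
     (\<forall>c. \<forall>x\<in>S. \<phi> (scV c x) = (\<lambda>h. scH c (\<phi> x h)))"

definition cgc ::
  "('v \<Rightarrow> 'v) \<Rightarrow> (nat \<Rightarrow> (nat \<Rightarrow> nat \<Rightarrow> 'v::zero) \<Rightarrow> real) \<Rightarrow> 'v set
     \<Rightarrow> ('h \<Rightarrow> 'h \<Rightarrow> complex) \<Rightarrow> ('v \<Rightarrow> 'h \<Rightarrow> 'h) \<Rightarrow> bool" where
  "cgc st \<nu> S ip \<phi> \<longleftrightarrow>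
     (\<forall>x\<in>S. \<forall>h g. ip (\<phi> (st x) h) g = ip h (\<phi> x g)) \<and>
     (\<forall>n\<ge>1. \<forall>A\<in>Msa st n. (\<forall>i j. A i j \<in> S) \<longrightarrow>
        dgauge ip n (\<lambda>i j. \<phi> (A i j)) \<le> \<nu> n A)"

end

theory Submission
  imports Defs "HOL-Library.Function_Algebras"
begin

text \<open>
  A completely gauge-contractive map \<open>\<phi>\<close> amounts to a real functional on the self-adjoint part of
  \<open>S \<otimes> H \<otimes> cnj H\<close> that is bounded on \<open>\<Sum> A i j \<otimes> \<xi> j \<otimes> cnj (\<xi> i)\<close> by \<open>\<nu> n A * \<Sum> \<parallel>\<xi> i\<parallel>\<^sup>2\<close>.
  Because \<open>\<nu>\<close> of a direct sum is the maximum, the infimum of these bounds over all representations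
  with \<open>A\<close> over \<open>V\<close> is sublinear, and because compression by a contraction does not increase \<open>\<nu>\<close>,
  it still dominates the functional of \<open>\<phi>\<close>. A Hahn--Banach extension of the functional to
  \<open>V \<otimes> H \<otimes> cnj H\<close> yields bounded sesquilinear forms on \<open>H\<close>, which the Riesz theorem
  turns into operators.
\<close>

section \<open>A Hahn--Banach theorem for convex cones\<close>

text \<open>Two points would have to be settled before an ordinary extension theorem applies: the
  functional of \<open>\<phi>\<close> depends only on the tensor and not on its representation over
  \<open>S\<close>, and it lies below the infimum over representations with entries anywhere in
  \<open>V\<close>. Both follow from one inequality, so the Hahn-Banach theorem is stated for a cone
  of pairs (tensor, upper bound) instead of a sublinear function and a functional on a subspace. The
  cone contains the graph of the functional of \<open>\<phi>\<close> with both signs, hence any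
  linear functional below the cone extends it, and the only substantial condition is that no pair
  \<open>(0, c)\<close> has \<open>c < 0\<close>. The functional is real and its bound one-sided
  because the gauges live on self-adjoint matrices and may differ at \<open>A\<close> and
  \<open>- A\<close>. Complex linearity is recovered at the end from the values at \<open>v\<close>
  and \<open>\<i> v\<close>.\<close>

lemma cone_dominates_linear_functional:
  fixes s :: "real \<Rightarrow> 'w::ab_group_add \<Rightarrow> 'w" and D :: "('w \<times> real) set"
  defines "W \<equiv> fst ` D"
  assumes "module s"
    and zero: "(0, 0) \<in> D"
    and add: "\<And>u c v d. (u, c) \<in> D \<Longrightarrow> (v, d) \<in> D \<Longrightarrow> (u + v, c + d) \<in> D"
    and scale: "\<And>u c t. (u, c) \<in> D \<Longrightarrow> 0 < t \<Longrightarrow> (s t u, t * c) \<in> D"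
    and minus: "\<And>u c. (u, c) \<in> D \<Longrightarrow> \<exists>d. (- u, d) \<in> D"
    and nonneg: "\<And>c. (0, c) \<in> D \<Longrightarrow> 0 \<le> c"
  shows "\<exists>F. (\<forall>u\<in>W. \<forall>v\<in>W. F (u + v) = F u + F v) \<and> (\<forall>t. \<forall>u\<in>W. F (s t u) = t * F u) \<and>
    (\<forall>u c. (u, c) \<in> D \<longrightarrow> F u \<le> c)"
proof -
  interpret module s by fact
  have W0: "0 \<in> W" using zero unfolding W_def by force
  have W_add: "u + v \<in> W" if "u \<in> W" "v \<in> W" for u v
    using that add unfolding W_def by force
  have W_minus: "- u \<in> W" if "u \<in> W" for u
    using that minus unfolding W_def by force
  have W_scale: "s t u \<in> W" if u: "u \<in> W" for t u
  proof -
    have pos: "s r u \<in> W" if "0 < r" for r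
      using scale[of u _ r] that u unfolding W_def by force
    consider "t = 0" | "0 < t" | "0 < - t" by linarith
    then show ?thesis
    proof cases
      case 3
      then have "- s (- t) u \<in> W" using pos W_minus by blast
      then show ?thesis by simp
    qed (use pos W0 in auto)
  qed
  define cones where "cones = {E. D \<subseteq> E \<and> fst ` E \<subseteq> W \<and>
    (\<forall>u c v d. (u, c) \<in> E \<longrightarrow> (v, d) \<in> E \<longrightarrow> (u + v, c + d) \<in> E) \<and>
    (\<forall>u c t. (u, c) \<in> E \<longrightarrow> 0 < t \<longrightarrow> (s t u, t * c) \<in> E) \<and> (\<forall>c. (0, c) \<in> E \<longrightarrow> 0 \<le> c)}"
  \<comment> \<open>A maximal consistent cone is the epigraph of the functional.\<close>
  have "\<exists>M\<in>cones. \<forall>X\<in>cones. M \<subseteq> X \<longrightarrow> X = M"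
  proof (rule subset_Zorn_nonempty)
    show "cones \<noteq> {}"
    proof -
      have "D \<in> cones" using add scale nonneg by (simp add: cones_def W_def)
      then show ?thesis by auto
    qed
    fix \<C> assume ne: "\<C> \<noteq> {}" and ch: "subset.chain cones \<C>"
    then have sub: "\<C> \<subseteq> cones" by (simp add: subset_chain_def)
    have "(u + v, c + d) \<in> \<Union>\<C>" if u: "(u, c) \<in> \<Union>\<C>" and v: "(v, d) \<in> \<Union>\<C>" for u c v d
    proof -
      obtain X Y where XY: "X \<in> \<C>" "Y \<in> \<C>" "(u, c) \<in> X" "(v, d) \<in> Y" using u v by blast
      then have "X \<subseteq> Y \<or> Y \<subseteq> X" using ch by (auto simp: subset_chain_def)
      then obtain Z where Z: "Z \<in> \<C>" "(u, c) \<in> Z" "(v, d) \<in> Z" using XY by blast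
      then have "(u + v, c + d) \<in> Z" using sub unfolding cones_def by blast
      then show ?thesis using Z by blast
    qed
    moreover have "D \<subseteq> \<Union>\<C>" using ne sub unfolding cones_def by blast
    moreover have "fst ` \<Union>\<C> \<subseteq> W" using sub unfolding cones_def by blast
    moreover have "(s t u, t * c) \<in> \<Union>\<C>" if "(u, c) \<in> \<Union>\<C>" "0 < t" for u c t
      using that sub unfolding cones_def by blast
    moreover have "0 \<le> c" if "(0, c) \<in> \<Union>\<C>" for c
      using that sub unfolding cones_def by blast
    ultimately show "\<Union>\<C> \<in> cones" by (simp add: cones_def)
  qed
  then obtain M where M: "M \<in> cones" and max: "\<And>X. X \<in> cones \<Longrightarrow> M \<subseteq> X \<Longrightarrow> X = M" by blast
  have DM: "D \<subseteq> M" and MW: "\<And>u c. (u, c) \<in> M \<Longrightarrow> u \<in> W"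
    and M_add: "\<And>u c v d. (u, c) \<in> M \<Longrightarrow> (v, d) \<in> M \<Longrightarrow> (u + v, c + d) \<in> M"
    and M_scale: "\<And>u c t. (u, c) \<in> M \<Longrightarrow> 0 < t \<Longrightarrow> (s t u, t * c) \<in> M"
    and M_nonneg: "\<And>c. (0, c) \<in> M \<Longrightarrow> 0 \<le> c"
    using M unfolding cones_def by (simp_all add: image_subset_iff) force
  \<comment> \<open>By maximality, adding the ray through a missing pair \<open>(u, c)\<close> must
    produce some \<open>(0, y)\<close> with \<open>y < 0\<close>, and this forces a pair over
    \<open>- u\<close> with bound below \<open>- c\<close>.\<close>
  have dichotomy: "(u, c) \<in> M \<or> (\<exists>d < - c. (- u, d) \<in> M)" if u: "u \<in> W" for u c
  proof (rule ccontr)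
    assume neg: "\<not> ?thesis"
    define E where "E = {(a + s t u, x + t * c) | a x t. (a, x) \<in> M \<and> 0 \<le> t}"
    have ME: "M \<subseteq> E"
    proof clarify
      fix a x assume "(a, x) \<in> M"
      then show "(a, x) \<in> E" unfolding E_def
        by (intro CollectI exI[of _ a] exI[of _ x] exI[of _ "0::real"]) simp
    qed
    have E_add: "(a + b, x + y) \<in> E" if ax: "(a, x) \<in> E" and yb: "(b, y) \<in> E" for a x b y
    proof -
      obtain a' x' t where 1: "(a', x') \<in> M" "0 \<le> t" "a = a' + s t u" "x = x' + t * c"
        using ax unfolding E_def by blast
      obtain b' y' r where 2: "(b', y') \<in> M" "0 \<le> r" "b = b' + s r u" "y = y' + r * c"
        using yb unfolding E_def by blast
      have "a + b = (a' + b') + s (t + r) u" "x + y = (x' + y') + (t + r) * c"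
        using 1 2 by (simp_all add: scale_left_distrib algebra_simps)
      then show ?thesis unfolding E_def using M_add[OF 1(1) 2(1)] 1(2) 2(2)
        by (intro CollectI exI[of _ "a' + b'"] exI[of _ "x' + y'"] exI[of _ "t + r"]) auto
    qed
    have E_scale: "(s r a, r * x) \<in> E" if ax: "(a, x) \<in> E" and r: "0 < r" for a x r
    proof -
      obtain a' x' t where 1: "(a', x') \<in> M" "0 \<le> t" "a = a' + s t u" "x = x' + t * c"
        using ax unfolding E_def by blast
      have "s r a = s r a' + s (r * t) u" "r * x = r * x' + (r * t) * c"
        using 1 by (simp_all add: scale_right_distrib algebra_simps)
      then show ?thesis unfolding E_def using M_scale[OF 1(1) r] 1(2) r
        by (intro CollectI exI[of _ "s r a'"] exI[of _ "r * x'"] exI[of _ "r * t"]) auto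
    qed
    have E_nonneg: "0 \<le> y" if y: "(0, y) \<in> E" for y
    proof -
      obtain a x t where 1: "(a, x) \<in> M" "0 \<le> t" "0 = a + s t u" "y = x + t * c"
        using y unfolding E_def by blast
      show ?thesis
      proof (cases "t = 0")
        case True
        then show ?thesis using 1 M_nonneg by simp
      next
        case False
        then have t: "0 < t" using 1 by simp
        have "a = - s t u" using 1(3) by (metis add_eq_0_iff minus_minus)
        then have "s (1 / t) a = - u" using t by simp
        then have "(- u, x / t) \<in> M" using M_scale[OF 1(1), of "1 / t"] t by simp
        then have "- c \<le> x / t" using neg by force
        then show ?thesis using t 1(4) by (simp add: field_simps)
      qed
    qed
    have "fst ` E \<subseteq> W" unfolding E_def using MW W_add W_scale u by force
    then have "E \<in> cones" using DM ME E_add E_scale E_nonneg by (simp add: cones_def)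
    then have "E = M" using max ME by blast
    moreover have "(u, c) \<in> E" unfolding E_def using zero DM
      by (intro CollectI exI[of _ "0::'w"] exI[of _ "0::real"] exI[of _ "1::real"]) auto
    ultimately show False using neg by blast
  qed
  define F where "F u = Inf {c. (u, c) \<in> M}" for u
  have ne: "{c. (u, c) \<in> M} \<noteq> {}" if "u \<in> W" for u
    using that DM unfolding W_def by force
  have opposite: "- d \<le> c" if "(u, c) \<in> M" "(- u, d) \<in> M" for u c d
    using M_nonneg[of "c + d"] M_add[OF that] by simp
  have bdd: "bdd_below {c. (u, c) \<in> M}" if "u \<in> W" for u
  proof -
    obtain d where "(- u, d) \<in> M" using ne[OF W_minus, of u] \<open>u \<in> W\<close> by blast
    then show ?thesis using opposite by (intro bdd_belowI[of _ "- d"]) blast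
  qed
  have F_le: "F u \<le> c" if "(u, c) \<in> M" for u c
    unfolding F_def using that bdd MW by (intro cInf_lower) auto
  have F_ge: "x \<le> F u" if "u \<in> W" "\<And>c. (u, c) \<in> M \<Longrightarrow> x \<le> c" for u x
    unfolding F_def using that ne by (intro cInf_greatest) auto
  have F_minus: "F (- u) = - F u" if u: "u \<in> W" for u
  proof (rule antisym)
    show "- F u \<le> F (- u)"
    proof (rule F_ge[OF W_minus[OF u]])
      fix d assume "(- u, d) \<in> M"
      then have "- d \<le> F u" using F_ge u opposite by blast
      then show "- F u \<le> d" by simp
    qed
    \<comment> \<open>For \<open>c\<close> below \<open>F u\<close> the pair \<open>(u, c)\<close>
      is outside \<open>M\<close>, so the dichotomy bounds \<open>F (- u)\<close>. This is the half
      of oddness that subadditivity cannot give; oddness then turns subadditivity into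
      additivity.\<close>
    have "F (- u) \<le> - c" if "c < F u" for c
      using dichotomy[OF u, of c] F_le that by fastforce
    then have "c \<le> - F (- u)" if "c < F u" for c using that by force
    then have "F u \<le> - F (- u)" by (rule dense_le)
    then show "F (- u) \<le> - F u" by simp
  qed
  have F_sub: "F (u + v) \<le> F u + F v" if u: "u \<in> W" and v: "v \<in> W" for u v
  proof -
    have "F (u + v) - F u \<le> F v"
    proof (rule F_ge[OF v])
      fix d assume d: "(v, d) \<in> M"
      have "F (u + v) - d \<le> F u"
      proof (rule F_ge[OF u])
        fix c assume "(u, c) \<in> M"
        then show "F (u + v) - d \<le> c" using F_le[OF M_add[OF _ d]] by fastforce
      qed
      then show "F (u + v) - F u \<le> d" by simp
    qed
    then show ?thesis by simp
  qed
  have F_add: "F (u + v) = F u + F v" if u: "u \<in> W" and v: "v \<in> W" for u v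
    using F_sub[OF u v] F_sub[OF W_minus[OF u] W_minus[OF v]] F_minus[OF W_add[OF u v]]
      F_minus[OF u] F_minus[OF v] by (simp add: add.commute)
  have F_scale_le: "F (s t u) \<le> t * F u" if u: "u \<in> W" and t: "0 < t" for t u
  proof -
    have "F (s t u) / t \<le> F u"
    proof (rule F_ge[OF u])
      fix c assume "(u, c) \<in> M"
      then show "F (s t u) / t \<le> c" using F_le[OF M_scale[OF _ t]] t by (simp add: field_simps)
    qed
    then show ?thesis using t by (simp add: field_simps)
  qed
  have F_scale_pos: "F (s t u) = t * F u" if u: "u \<in> W" and t: "0 < t" for t u
  proof (rule antisym[OF F_scale_le[OF u t]])
    show "t * F u \<le> F (s t u)"
      using F_scale_le[OF W_scale[OF u, of t], of "1 / t"] t by (simp add: field_simps)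
  qed
  have F_scale: "F (s t u) = t * F u" if u: "u \<in> W" for t u
  proof -
    consider "t = 0" | "0 < t" | "0 < - t" by linarith
    then show ?thesis
    proof cases
      case 1
      then show ?thesis using F_minus[OF W0] by simp
    next
      case 3
      have "F (s t u) = F (- s (- t) u)" by simp
      also have "\<dots> = - F (s (- t) u)" using F_minus[OF W_scale[OF u]] .
      finally show ?thesis using F_scale_pos[OF u 3] by simp
    qed (use F_scale_pos u in auto)
  qed
  show ?thesis using F_add F_scale F_le DM by (intro exI[of _ F]) blast
qed

section \<open>Complex inner product spaces\<close>

locale complex_inner_product = module sc for sc :: "complex \<Rightarrow> 'h::ab_group_add \<Rightarrow> 'h" +
  fixes ip :: "'h \<Rightarrow> 'h \<Rightarrow> complex"
  assumes ip_add_left: "ip (x + y) z = ip x z + ip y z"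
    and ip_scale_left: "ip (sc c x) y = c * ip x y"
    and ip_cnj: "cnj (ip x y) = ip y x"
    and ip_nonneg: "0 \<le> Re (ip x x)"
    and ip_definite: "ip x x = 0 \<Longrightarrow> x = 0"
begin

lemma ip_add_right: "ip x (y + z) = ip x y + ip x z"
  by (metis ip_cnj ip_add_left complex_cnj_add)

lemma ip_scale_right: "ip x (sc c y) = cnj c * ip x y"
  by (metis ip_cnj ip_scale_left complex_cnj_mult)

lemma ip_zero_left [simp]: "ip 0 x = 0"
  using ip_add_left[of 0 0 x] by simp

lemma ip_zero_right [simp]: "ip x 0 = 0"
  using ip_add_right[of x 0 0] by simp

lemma ip_minus_left: "ip (- x) y = - ip x y"
  using ip_add_left[of x "- x" y] by (simp add: add_eq_0_iff)

lemma ip_minus_right: "ip x (- y) = - ip x y"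
  using ip_add_right[of x y "- y"] by (simp add: add_eq_0_iff)

lemma ip_diff_left: "ip (x - y) z = ip x z - ip y z"
  using ip_add_left[of x "- y" z] by (simp add: ip_minus_left)

lemma ip_diff_right: "ip x (y - z) = ip x y - ip x z"
  using ip_add_right[of x y "- z"] by (simp add: ip_minus_right)

lemma ip_sum_left: "ip (sum f I) y = (\<Sum>i\<in>I. ip (f i) y)"
  by (induction I rule: infinite_finite_induct) (auto simp: ip_add_left)

lemma ip_sum_right: "ip x (sum f I) = (\<Sum>i\<in>I. ip x (f i))"
  by (induction I rule: infinite_finite_induct) (auto simp: ip_add_right)

lemma ip_self: "ip x x = complex_of_real (Re (ip x x))"
  using ip_cnj[of x x] by (simp add: complex_eq_iff)

lemma Re_ip_self_eq_0: "Re (ip x x) = 0 \<longleftrightarrow> x = 0"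
  using ip_self[of x] ip_definite[of x] by auto

lemma ip_left_cancel: "(\<And>z. ip x z = ip y z) \<Longrightarrow> x = y"
  using ip_definite[of "x - y"] by (simp add: ip_diff_left)

text \<open>Dependent families are allowed: a vector whose residue \<open>w\<close> vanishes adds no
  new \<open>e\<close>, so \<open>k\<close> may fall below \<open>m\<close>, even to 0.\<close>

lemma gram_schmidt:
  fixes v :: "nat \<Rightarrow> 'h" and m :: nat
  shows "\<exists>k e. k \<le> m \<and> (\<forall>p<k. \<forall>q<k. ip (e p) (e q) = (if p = q then 1 else 0)) \<and>
     (\<forall>i<m. v i = (\<Sum>p<k. sc (ip (v i) (e p)) (e p)))"
proof (induction m)
  case 0
  then show ?case by auto
next
  case (Suc m)
  then obtain k e where k: "k \<le> m"
    and on: "\<And>p q. p < k \<Longrightarrow> q < k \<Longrightarrow> ip (e p) (e q) = (if p = q then 1 else 0)"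
    and sp: "\<And>i. i < m \<Longrightarrow> v i = (\<Sum>p<k. sc (ip (v i) (e p)) (e p))"
    by blast
  define w where "w = v m - (\<Sum>p<k. sc (ip (v m) (e p)) (e p))"
  show ?case
  proof (cases "w = 0")
    case True
    then have "v m = (\<Sum>p<k. sc (ip (v m) (e p)) (e p))" by (simp add: w_def)
    then show ?thesis using k on sp
      by (intro exI[of _ k] exI[of _ e]) (auto simp: less_Suc_eq)
  next
    case False
    define r where "r = sqrt (Re (ip w w))"
    have r: "0 < r" using False ip_nonneg[of w] Re_ip_self_eq_0[of w] by (simp add: r_def)
    have rr: "ip w w = complex_of_real r * complex_of_real r"
      using ip_nonneg[of w] by (subst ip_self) (simp add: r_def flip: of_real_mult)
    define e' where "e' = e(k := sc (complex_of_real (1 / r)) w)"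
    have we: "ip w (e q) = 0" if "q < k" for q
      using that by (simp add: w_def ip_diff_left ip_sum_left ip_scale_left on if_distrib cong: if_cong)
    have ew: "ip (e q) w = 0" if "q < k" for q
      using we[OF that] ip_cnj[of w "e q"] by simp
    have on': "ip (e' p) (e' q) = (if p = q then 1 else 0)" if "p < Suc k" "q < Suc k" for p q
      using that r
      by (auto simp: e'_def less_Suc_eq on we ew rr ip_scale_left ip_scale_right)
    have vw: "ip (v i) w = 0" if "i < m" for i
      by (subst sp[OF that]) (simp add: ip_sum_left ip_scale_left ew)
    have vmw: "ip (v m) w = ip w w"
    proof -
      have "v m = w + (\<Sum>p<k. sc (ip (v m) (e p)) (e p))" by (simp add: w_def)
      then have "ip (v m) w = ip w w + ip (\<Sum>p<k. sc (ip (v m) (e p)) (e p)) w"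
        by (metis ip_add_left)
      then show ?thesis by (simp add: ip_sum_left ip_scale_left ew)
    qed
    have "v i = (\<Sum>p<Suc k. sc (ip (v i) (e' p)) (e' p))" if "i < Suc m" for i
    proof (cases "i = m")
      case True
      have "sc (ip (v m) (e' k)) (e' k) = w"
        using r by (simp add: e'_def ip_scale_right vmw rr)
      then show ?thesis using True by (simp add: e'_def w_def)
    next
      case False
      then have i: "i < m" using that by simp
      show ?thesis using sp[OF i] vw[OF i] by (simp add: e'_def ip_scale_right)
    qed
    then show ?thesis using k on'
      by (intro exI[of _ "Suc k"] exI[of _ e']) auto
  qed
qed

section \<open>Cauchy-Schwarz inequality and Riesz representation\<close>

lemma cauchy_schwarz: "cmod (ip x y) \<le> hnorm ip x * hnorm ip y"
proof (cases "y = 0")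
  case True
  then show ?thesis by (simp add: hnorm_def)
next
  case False
  define n where "n = Re (ip y y)"
  have n: "0 < n" using False ip_nonneg[of y] Re_ip_self_eq_0[of y] by (simp add: n_def)
  have yy: "ip y y = complex_of_real n" unfolding n_def by (rule ip_self)
  define c where "c = ip x y / n"
  have "ip (x - sc c y) (x - sc c y)
      = ip x x - cnj c * ip x y - c * ip y x + c * cnj c * ip y y"
    by (simp add: ip_diff_left ip_diff_right ip_scale_left ip_scale_right algebra_simps)
  also have "\<dots> = ip x x - ip x y * cnj (ip x y) / n"
    using n by (simp add: c_def yy field_simps flip: ip_cnj[of x y])
  also have "\<dots> = ip x x - complex_of_real ((cmod (ip x y))\<^sup>2 / n)"
    by (simp add: complex_norm_square [symmetric])
  finally have "0 \<le> Re (ip x x) - (cmod (ip x y))\<^sup>2 / n"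
    using ip_nonneg[of "x - sc c y"] by simp
  then have "(cmod (ip x y))\<^sup>2 \<le> Re (ip x x) * n" using n by (simp add: field_simps)
  then have "cmod (ip x y) \<le> sqrt (Re (ip x x) * n)" by (rule real_le_rsqrt)
  then show ?thesis by (simp add: hnorm_def n_def real_sqrt_mult)
qed

lemma hnorm_nonneg: "0 \<le> hnorm ip x"
  by (simp add: hnorm_def ip_nonneg)

lemma hnorm_square: "(hnorm ip x)\<^sup>2 = Re (ip x x)"
  by (simp add: hnorm_def ip_nonneg)

lemma hnorm_eq_0: "hnorm ip x = 0 \<longleftrightarrow> x = 0"
  by (simp add: hnorm_def Re_ip_self_eq_0)

lemma riesz_representation:
  assumes complete: "\<And>u::nat \<Rightarrow> 'h. (\<forall>e>0. \<exists>N. \<forall>m\<ge>N. \<forall>n\<ge>N. hnorm ip (u m - u n) < e) \<Longrightarrow>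
      \<exists>l. \<forall>e>0. \<exists>N. \<forall>n\<ge>N. hnorm ip (u n - l) < e"
    and f_add: "\<And>x y. f (x + y) = f x + f y" and f_scale: "\<And>c x. f (sc c x) = c * f x"
    and f_bound: "\<And>x. cmod (f x) \<le> K * hnorm ip x"
  shows "\<exists>y. \<forall>x. f x = ip x y"
proof -
  \<comment> \<open>The representing vector is the limit of a minimising sequence of \<open>J\<close>.\<close>
  define J where "J y = Re (ip y y) - 2 * Re (f y)" for y
  have J_bound: "- K\<^sup>2 \<le> J y" for y
  proof -
    have "Re (f y) \<le> K * hnorm ip y" using f_bound[of y] complex_Re_le_cmod[of "f y"] by linarith
    moreover have "0 \<le> (hnorm ip y - K)\<^sup>2" by simp
    ultimately show ?thesis
      unfolding J_def hnorm_square[symmetric] by (simp add: power2_eq_square algebra_simps)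
  qed
  define m where "m = Inf (range J)"
  have bdd: "bdd_below (range J)" using J_bound by (auto intro!: bdd_belowI)
  have m_le: "m \<le> J y" for y unfolding m_def using bdd by (intro cInf_lower) auto
  have "\<exists>y. J y < m + 1 / real (Suc n)" for n
    using cInf_lessD[of "range J" "m + 1 / real (Suc n)"] by (auto simp: m_def)
  then obtain y where y: "\<And>n. J (y n) < m + 1 / real (Suc n)" by metis
  \<comment> \<open>The linear part of \<open>J\<close> cancels in the parallelogram law, so nearly
    minimal points are close to each other.\<close>
  have parallelogram: "Re (ip (a - b) (a - b)) = 2 * J a + 2 * J b - 4 * J (sc (1 / 2) (a + b))" for a b
    by (simp add: J_def ip_add_left ip_add_right ip_diff_left ip_diff_right ip_scale_left
        ip_scale_right f_add f_scale algebra_simps)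
  have close: "Re (ip (y i - y k) (y i - y k)) \<le> 2 / real (Suc i) + 2 / real (Suc k)" for i k
    using parallelogram[of "y i" "y k"] y[of i] y[of k] m_le[of "sc (1 / 2) (y i + y k)"] by simp
  have "\<forall>e>0. \<exists>N. \<forall>i\<ge>N. \<forall>k\<ge>N. hnorm ip (y i - y k) < e"
  proof (intro allI impI)
    fix e :: real assume e: "0 < e"
    then obtain N where N: "1 / real (Suc N) < e\<^sup>2 / 4"
      using nat_approx_posE[of "e\<^sup>2 / 4"] by auto
    have "hnorm ip (y i - y k) < e" if "N \<le> i" "N \<le> k" for i k
    proof -
      have "1 / real (Suc i) \<le> 1 / real (Suc N)" "1 / real (Suc k) \<le> 1 / real (Suc N)"
        using that by (auto intro!: divide_left_mono)
      then have "Re (ip (y i - y k) (y i - y k)) < e\<^sup>2" using close[of i k] N by simp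
      then show ?thesis unfolding hnorm_def using e by (simp add: real_less_lsqrt)
    qed
    then show "\<exists>N. \<forall>i\<ge>N. \<forall>k\<ge>N. hnorm ip (y i - y k) < e" by blast
  qed
  then obtain l where l: "\<forall>e>0. \<exists>N. \<forall>n\<ge>N. hnorm ip (y n - l) < e" using complete by blast
  have "(\<lambda>n. hnorm ip (y n - l)) \<longlonglongrightarrow> 0"
    unfolding LIMSEQ_iff using l by (auto simp: hnorm_nonneg)
  have lim: "(\<lambda>n. ip (y n) x) \<longlonglongrightarrow> ip l x" for x
  proof -
    have "(\<lambda>n. ip (y n - l) x) \<longlonglongrightarrow> 0"
      by (rule tendsto_0_le[OF \<open>(\<lambda>n. hnorm ip (y n - l)) \<longlonglongrightarrow> 0\<close>, of _ "hnorm ip x"])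
        (simp add: cauchy_schwarz hnorm_nonneg)
    then show ?thesis by (simp add: ip_diff_left LIM_zero_iff)
  qed
  have Re_eq: "Re (ip l x) = Re (f x)" for x
  proof -
    define d where "d = Re (ip l x) - Re (f x)"
    define X where "X = Re (ip x x)"
    have X: "0 \<le> X" by (simp add: X_def ip_nonneg)
    \<comment> \<open>\<open>2 * d\<close> is the slope of \<open>J\<close> at \<open>l\<close> in
      direction \<open>x\<close>. Minimality is expanded at \<open>y n\<close> and then passed to
      the limit, so that only continuity of \<open>ip\<close> in its left argument is used.\<close>
    have variation: "0 \<le> 2 * t * d + t\<^sup>2 * X" for t
    proof -
      have J_shift: "J (z + sc (complex_of_real t) x)
          = J z + 2 * t * (Re (ip z x) - Re (f x)) + t\<^sup>2 * X" for z
        using ip_cnj[of z x] by (simp add: J_def X_def ip_add_left ip_add_right ip_scale_left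
            ip_scale_right f_add f_scale power2_eq_square algebra_simps flip: ip_cnj[of z x])
      have "0 \<le> 1 / real (Suc n) + 2 * t * (Re (ip (y n) x) - Re (f x)) + t\<^sup>2 * X" for n
        using J_shift[of "y n"] y[of n] m_le[of "y n + sc (complex_of_real t) x"] by linarith
      moreover have "(\<lambda>n. 1 / real (Suc n) + 2 * t * (Re (ip (y n) x) - Re (f x)) + t\<^sup>2 * X)
          \<longlonglongrightarrow> 0 + 2 * t * d + t\<^sup>2 * X"
        unfolding d_def
        by (intro tendsto_intros lim LIMSEQ_Suc[OF lim_1_over_n])
      ultimately have "0 \<le> 0 + 2 * t * d + t\<^sup>2 * X" by (intro LIMSEQ_le_const) auto
      then show ?thesis by simp
    qed
    \<comment> \<open>The step \<open>t = - d * r\<close> is short enough for the linear term to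
      beat the quadratic one, and \<open>X + 1\<close> is never zero.\<close>
    define r where "r = 1 / (X + 1)"
    have "0 < r" "r * X \<le> 1" using X by (auto simp: r_def field_simps)
    then have neg: "r * (r * X - 2) < 0" by (simp add: mult_pos_neg)
    have "0 \<le> d\<^sup>2 * (r * (r * X - 2))"
      using variation[of "- (d * r)"] by (simp add: power2_eq_square algebra_simps)
    then have "d = 0" using mult_pos_neg[OF _ neg, of "d\<^sup>2"] by fastforce
    then show ?thesis by (simp add: d_def)
  qed
  have Re_eq': "Re (f x) = Re (ip x l)" for x
    using Re_eq[of x] by (simp flip: ip_cnj[of l x])
  have "f x = ip x l" for x
  proof (rule complex_eqI)
    show "Re (f x) = Re (ip x l)" by (rule Re_eq')
    have "Re (f (sc (- \<i>) x)) = Re (ip (sc (- \<i>) x) l)" by (rule Re_eq')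
    then show "Im (f x) = Im (ip x l)" unfolding f_scale ip_scale_left by simp
  qed
  then show ?thesis by blast
qed

end

section \<open>Finite sums and scalar matrices\<close>

lemma sum_lessThan_add:
  fixes f :: "nat \<Rightarrow> 'a::comm_monoid_add"
  shows "(\<Sum>i<n + m. f i) = (\<Sum>i<n. f i) + (\<Sum>i<m. f (n + i))"
  by (induction m) (auto simp: add.assoc)

text \<open>The off-diagonal blocks of \<open>dsum\<close> vanish. \<open>G\<close> is left abstract
  so that tensors and quadratic forms share the computation.\<close>

lemma double_sum_dsum:
  fixes G :: "'v::zero \<Rightarrow> 'h \<Rightarrow> 'h \<Rightarrow> 'a::comm_monoid_add"
  assumes "\<And>x y. G 0 x y = 0"
  shows "(\<Sum>i<n + m. \<Sum>j<n + m. G (dsum n A B i j) (if i < n then \<xi> i else \<eta> (i - n))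
           (if j < n then \<xi> j else \<eta> (j - n)))
    = (\<Sum>i<n. \<Sum>j<n. G (A i j) (\<xi> i) (\<xi> j)) + (\<Sum>i<m. \<Sum>j<m. G (B i j) (\<eta> i) (\<eta> j))"
  by (simp add: sum_lessThan_add dsum_def assms)

lemma sum_rotate3:
  "(\<Sum>i\<in>I. \<Sum>j\<in>J. \<Sum>p\<in>P. X i j p) = (\<Sum>p\<in>P. \<Sum>i\<in>I. \<Sum>j\<in>J. X i j p)"
proof -
  have "(\<Sum>j\<in>J. \<Sum>p\<in>P. X i j p) = (\<Sum>p\<in>P. \<Sum>j\<in>J. X i j p)" for i
    by (rule sum.swap)
  then have "(\<Sum>i\<in>I. \<Sum>j\<in>J. \<Sum>p\<in>P. X i j p) = (\<Sum>i\<in>I. \<Sum>p\<in>P. \<Sum>j\<in>J. X i j p)"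
    by simp
  also have "\<dots> = (\<Sum>p\<in>P. \<Sum>i\<in>I. \<Sum>j\<in>J. X i j p)" by (rule sum.swap)
  finally show ?thesis .
qed

lemma sum_swap4:
  "(\<Sum>i\<in>I. \<Sum>j\<in>J. \<Sum>p\<in>P. \<Sum>q\<in>Q. X i j p q) = (\<Sum>p\<in>P. \<Sum>q\<in>Q. \<Sum>i\<in>I. \<Sum>j\<in>J. X i j p q)"
  by (rule trans[OF sum_rotate3], rule sum.cong[OF refl], rule sum_rotate3)

lemma cmat_norm_square_le_1:
  assumes "\<And>c. (\<Sum>i<n. (cmod (\<Sum>j<k. Z i j * c j))\<^sup>2) \<le> (\<Sum>j<k. (cmod (c j))\<^sup>2)"
  shows "(cmat_norm n k Z)\<^sup>2 \<le> 1"
proof -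
  define T where "T = {sqrt (\<Sum>i<n. (cmod (\<Sum>j<k. Z i j * \<xi> j))\<^sup>2) | \<xi>.
      (\<Sum>j<k. (cmod (\<xi> j))\<^sup>2) \<le> 1}"
  have le: "t \<le> 1" if "t \<in> T" for t
    using that order_trans[OF assms] by (auto simp: T_def)
  \<comment> \<open>The zero vector makes \<open>T\<close> nonempty and its supremum nonnegative, so
    that an upper bound on \<open>Sup T\<close> also bounds its square.\<close>
  have zero: "0 \<in> T" unfolding T_def by (intro CollectI exI[of _ "\<lambda>_. 0"]) simp
  have "Sup T \<le> 1" using le zero by (intro cSup_least) auto
  moreover have "0 \<le> Sup T" using le zero by (intro cSup_upper bdd_aboveI[of _ 1]) auto
  ultimately show ?thesis unfolding cmat_norm_def T_def[symmetric] by (simp add: power_le_one)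
qed

section \<open>Gauges and tensors\<close>

locale gauge_contractive_map =
  fixes scV :: "complex \<Rightarrow> 'v::ab_group_add \<Rightarrow> 'v" and st :: "'v \<Rightarrow> 'v"
    and \<nu> :: "nat \<Rightarrow> (nat \<Rightarrow> nat \<Rightarrow> 'v) \<Rightarrow> real" and S :: "'v set"
    and scH :: "complex \<Rightarrow> 'h::ab_group_add \<Rightarrow> 'h" and ip :: "'h \<Rightarrow> 'h \<Rightarrow> complex"
    and \<phi> :: "'v \<Rightarrow> 'h \<Rightarrow> 'h"
  assumes mos: "Linf_MOS scV st \<nu>"
    and subspace: "selfadjoint_subspace scV st S"
    and hilbert: "hilbert_space scH ip"
    and linear: "linear_into_BH scV S scH ip \<phi>"
    and contractive: "cgc st \<nu> S ip \<phi>"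
begin

sublocale V: module scV
  using mos unfolding Linf_MOS_def star_vector_space_def by blast

sublocale H: complex_inner_product scH ip
proof -
  interpret module scH using hilbert unfolding hilbert_space_def by blast
  have "\<And>x y z. ip (x + y) z = ip x z + ip y z" "\<And>c x y. ip (scH c x) y = c * ip x y"
    "\<And>x y. cnj (ip x y) = ip y x" "\<And>x. 0 \<le> Re (ip x x)" "\<And>x. ip x x = 0 \<Longrightarrow> x = 0"
    using hilbert unfolding hilbert_space_def by metis+
  then show "complex_inner_product scH ip" by unfold_locales
qed

section \<open>Consequences of the axioms\<close>

lemma star: "star_vector_space scV st"
  using mos unfolding Linf_MOS_def by blast

lemma st_add: "st (x + y) = st x + st y"
  using star unfolding star_vector_space_def by blast

lemma st_scale: "st (scV c x) = scV (cnj c) (st x)"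
  using star unfolding star_vector_space_def by blast

lemma st_st [simp]: "st (st x) = x"
  using star unfolding star_vector_space_def by blast

lemma st_zero [simp]: "st 0 = 0"
  using st_add[of 0 0] by simp

lemma st_minus: "st (- x) = - st x"
  using st_add[of x "- x"] by (simp add: add_eq_0_iff)

lemma st_sum: "st (sum f I) = (\<Sum>i\<in>I. st (f i))"
  by (induction I rule: infinite_finite_induct) (auto simp: st_add)

lemma Msa_outside: "A \<in> Msa st n \<Longrightarrow> n \<le> i \<or> n \<le> j \<Longrightarrow> A i j = 0"
  unfolding Msa_def in_Mn_def by blast

lemma Msa_st:
  assumes "A \<in> Msa st n"
  shows "st (A i j) = A j i"
proof (cases "i < n \<and> j < n")
  case True
  then have "A j i = st (A i j)" using assms unfolding Msa_def mat_selfadj_def by blast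
  then show ?thesis by (rule sym)
next
  case False
  then show ?thesis using Msa_outside[OF assms, of i j] Msa_outside[OF assms, of j i] by force
qed

lemma MsaI:
  assumes "\<And>i j. n \<le> i \<or> n \<le> j \<Longrightarrow> A i j = 0"
    and "\<And>i j. i < n \<Longrightarrow> j < n \<Longrightarrow> st (A i j) = A j i"
  shows "A \<in> Msa st n"
  unfolding Msa_def in_Mn_def mat_selfadj_def using assms(1) assms(2)[symmetric] by blast

lemma Msa_zero: "(\<lambda>i j. 0) \<in> Msa st n"
  by (rule MsaI) simp_all

lemma Msa_minus: "A \<in> Msa st n \<Longrightarrow> (\<lambda>i j. - A i j) \<in> Msa st n"
  by (rule MsaI) (simp_all add: Msa_outside Msa_st st_minus)

lemma Msa_scale: "A \<in> Msa st n \<Longrightarrow> (\<lambda>i j. scV (complex_of_real t) (A i j)) \<in> Msa st n"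
  by (rule MsaI) (simp_all add: Msa_outside Msa_st st_scale)

lemma Msa_dsum: "A \<in> Msa st n \<Longrightarrow> B \<in> Msa st m \<Longrightarrow> dsum n A B \<in> Msa st (n + m)"
  by (rule MsaI) (auto simp: dsum_def Msa_st intro!: Msa_outside[of B m])

lemma gauge_nonneg: "1 \<le> n \<Longrightarrow> A \<in> Msa st n \<Longrightarrow> 0 \<le> \<nu> n A"
  using mos unfolding Linf_MOS_def by blast

lemma gauge_scale: "1 \<le> n \<Longrightarrow> A \<in> Msa st n \<Longrightarrow> 0 < t \<Longrightarrow>
    \<nu> n (\<lambda>i j. scV (complex_of_real t) (A i j)) = t * \<nu> n A"
  using mos unfolding Linf_MOS_def by blast

lemma gauge_compress: "1 \<le> n \<Longrightarrow> 1 \<le> k \<Longrightarrow> A \<in> Msa st n \<Longrightarrow>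
    \<nu> k (compress scV n k X A) \<le> (cmat_norm n k X)\<^sup>2 * \<nu> n A"
  using mos unfolding Linf_MOS_def by blast

lemma gauge_dsum: "1 \<le> n \<Longrightarrow> 1 \<le> m \<Longrightarrow> A \<in> Msa st n \<Longrightarrow> B \<in> Msa st m \<Longrightarrow>
    \<nu> (n + m) (dsum n A B) = max (\<nu> n A) (\<nu> m B)"
  using mos unfolding Linf_MOS_def by blast

lemma gauge_zero: "1 \<le> n \<Longrightarrow> \<nu> n (\<lambda>i j. 0) = 0"
  using gauge_scale[OF _ Msa_zero, of n 2] by simp

lemma S_zero: "0 \<in> S" and S_add: "x \<in> S \<Longrightarrow> y \<in> S \<Longrightarrow> x + y \<in> S"
  and S_scale: "x \<in> S \<Longrightarrow> scV c x \<in> S" and S_st: "x \<in> S \<Longrightarrow> st x \<in> S"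
  using subspace unfolding selfadjoint_subspace_def by simp_all

lemma S_sum: "(\<And>i. i \<in> I \<Longrightarrow> f i \<in> S) \<Longrightarrow> sum f I \<in> S"
  by (induction I rule: infinite_finite_induct) (auto simp: S_zero S_add)

lemma S_minus: "x \<in> S \<Longrightarrow> - x \<in> S"
  using S_scale[of x "- 1"] by simp

lemma map_add:
  assumes "x \<in> S" "y \<in> S"
  shows "\<phi> (x + y) h = \<phi> x h + \<phi> y h"
proof -
  have "\<phi> (x + y) = (\<lambda>h. \<phi> x h + \<phi> y h)"
    using linear assms unfolding linear_into_BH_def by blast
  then show ?thesis by (rule fun_cong)
qed

lemma map_scale:
  assumes "x \<in> S"
  shows "\<phi> (scV c x) h = scH c (\<phi> x h)"
proof -
  have "\<phi> (scV c x) = (\<lambda>h. scH c (\<phi> x h))"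
    using linear assms unfolding linear_into_BH_def by blast
  then show ?thesis by (rule fun_cong)
qed

lemma op_add: "x \<in> S \<Longrightarrow> \<phi> x (h + g) = \<phi> x h + \<phi> x g"
  using linear unfolding linear_into_BH_def bounded_op_def by blast

lemma op_scale: "x \<in> S \<Longrightarrow> \<phi> x (scH c h) = scH c (\<phi> x h)"
  using linear unfolding linear_into_BH_def bounded_op_def by blast

lemma op_bounded: "x \<in> S \<Longrightarrow> \<exists>K. \<forall>h. hnorm ip (\<phi> x h) \<le> K * hnorm ip h"
  using linear unfolding linear_into_BH_def bounded_op_def by blast

lemma map_zero: "\<phi> 0 h = 0"
  using map_add[OF S_zero S_zero, of h] by simp

lemma map_minus: "x \<in> S \<Longrightarrow> \<phi> (- x) h = - \<phi> x h"
  using map_scale[of x "- 1" h] by simp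

lemma map_sum: "(\<And>i. i \<in> I \<Longrightarrow> f i \<in> S) \<Longrightarrow> \<phi> (sum f I) h = (\<Sum>i\<in>I. \<phi> (f i) h)"
  by (induction I rule: infinite_finite_induct) (auto simp: map_zero map_add S_sum)

lemma op_zero: "x \<in> S \<Longrightarrow> \<phi> x 0 = 0"
  using op_add[of x 0 0] by simp

lemma op_sum: "x \<in> S \<Longrightarrow> \<phi> x (sum f I) = (\<Sum>i\<in>I. \<phi> x (f i))"
  by (induction I rule: infinite_finite_induct) (auto simp: op_zero op_add)

lemma map_adjoint: "x \<in> S \<Longrightarrow> ip (\<phi> (st x) h) g = ip h (\<phi> x g)"
  using contractive unfolding cgc_def by blast

section \<open>Quadratic forms and self-adjoint tensors\<close>

definition sqnorm :: "nat \<Rightarrow> (nat \<Rightarrow> 'h) \<Rightarrow> real" where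
  "sqnorm n \<xi> = (\<Sum>i<n. Re (ip (\<xi> i) (\<xi> i)))"

definition form :: "nat \<Rightarrow> (nat \<Rightarrow> nat \<Rightarrow> 'v) \<Rightarrow> (nat \<Rightarrow> 'h) \<Rightarrow> real" where
  "form n B \<eta> = Re (\<Sum>i<n. \<Sum>j<n. ip (\<phi> (B i j) (\<eta> j)) (\<eta> i))"

text \<open>
  \<open>elem n A \<xi>\<close> stands for the tensor \<open>\<Sum> A i j \<otimes> \<xi> j \<otimes> cnj (\<xi> i)\<close> in \<open>V \<otimes> H \<otimes> cnj H\<close>, realised as the
  \<open>V\<close>-valued sesquilinear function it induces on \<open>H\<close> through the inner product.
\<close>

definition elem :: "nat \<Rightarrow> (nat \<Rightarrow> nat \<Rightarrow> 'v) \<Rightarrow> (nat \<Rightarrow> 'h) \<Rightarrow> 'h \<Rightarrow> 'h \<Rightarrow> 'v" where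
  "elem n A \<xi> = (\<lambda>h g. \<Sum>i<n. \<Sum>j<n. scV (ip h (\<xi> i) * ip (\<xi> j) g) (A i j))"

text \<open>Real scalars only, because a complex multiple of a self-adjoint tensor need not be
  self-adjoint.\<close>

definition scW :: "real \<Rightarrow> ('h \<Rightarrow> 'h \<Rightarrow> 'v) \<Rightarrow> 'h \<Rightarrow> 'h \<Rightarrow> 'v" where
  "scW t u = (\<lambda>h g. scV (complex_of_real t) (u h g))"

lemma module_scW: "module scW"
  by unfold_locales (auto simp: scW_def fun_eq_iff V.scale_right_distrib V.scale_left_distrib)

lemma sqnorm_nonneg: "0 \<le> sqnorm n \<xi>"
  by (simp add: sqnorm_def sum_nonneg H.ip_nonneg)

lemma sqnorm_scale: "sqnorm n (\<lambda>i. scH (complex_of_real r) (\<xi> i)) = r\<^sup>2 * sqnorm n \<xi>"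
  by (simp add: sqnorm_def H.ip_scale_left H.ip_scale_right sum_distrib_left power2_eq_square
      mult.assoc)

lemma elem_scale: "elem n (\<lambda>i j. scV (complex_of_real t) (A i j)) \<xi> = scW t (elem n A \<xi>)"
  by (simp add: elem_def scW_def V.scale_sum_right mult.commute)

lemma elem_scale_vectors: "elem n A (\<lambda>i. scH (complex_of_real r) (\<xi> i)) = scW (r\<^sup>2) (elem n A \<xi>)"
  by (simp add: elem_def scW_def V.scale_sum_right H.ip_scale_left H.ip_scale_right
      power2_eq_square mult_ac)

lemma elem_minus: "elem n (\<lambda>i j. - A i j) \<xi> = - elem n A \<xi>"
  by (simp add: elem_def fun_eq_iff sum_negf)

lemma elem_zero: "elem n (\<lambda>i j. 0) \<xi> = 0"
  by (simp add: elem_def fun_eq_iff)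

lemma form_scale: "(\<And>i j. B i j \<in> S) \<Longrightarrow>
    form n (\<lambda>i j. scV (complex_of_real t) (B i j)) \<eta> = t * form n B \<eta>"
  by (simp add: form_def map_scale H.ip_scale_left flip: sum_distrib_left)

lemma form_minus: "(\<And>i j. B i j \<in> S) \<Longrightarrow> form n (\<lambda>i j. - B i j) \<eta> = - form n B \<eta>"
  by (simp add: form_def map_minus H.ip_minus_left sum_negf)

lemma form_zero: "form n (\<lambda>i j. 0) \<eta> = 0"
  by (simp add: form_def map_zero)

definition cat :: "nat \<Rightarrow> (nat \<Rightarrow> 'h) \<Rightarrow> (nat \<Rightarrow> 'h) \<Rightarrow> nat \<Rightarrow> 'h" where
  "cat n \<xi> \<eta> = (\<lambda>i. if i < n then \<xi> i else \<eta> (i - n))"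

lemma sqnorm_cat: "sqnorm (n + m) (cat n \<xi> \<eta>) = sqnorm n \<xi> + sqnorm m \<eta>"
  by (simp add: sqnorm_def cat_def sum_lessThan_add)

lemma elem_cat: "elem (n + m) (dsum n A B) (cat n \<xi> \<eta>) = elem n A \<xi> + elem m B \<eta>"
  unfolding elem_def cat_def fun_eq_iff plus_fun_apply
  by (intro allI, rule double_sum_dsum) simp

lemma form_cat: "form (n + m) (dsum n A B) (cat n \<xi> \<eta>) = form n A \<xi> + form m B \<eta>"
  unfolding form_def cat_def
  by (subst double_sum_dsum[of "\<lambda>x h g. ip (\<phi> x g) h"]) (simp_all add: map_zero)

text \<open>The tensor is linear in the matrix and quadratic in the vectors, so a factor
  \<open>1 / c\<close> on \<open>A\<close> and \<open>sqrt c\<close> on the vectors moves the gauge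
  into the squared norm. Any positive \<open>c\<close> above the gauge will do, which covers gauge
  zero.\<close>

lemma elem_normalise:
  assumes n: "1 \<le> n" and A: "A \<in> Msa st n" and c: "0 < c" "\<nu> n A \<le> c"
  obtains A' \<xi>' where "A' \<in> Msa st n" "\<nu> n A' \<le> 1" "elem n A' \<xi>' = elem n A \<xi>"
    "sqnorm n \<xi>' = c * sqnorm n \<xi>"
proof
  define A' where "A' = (\<lambda>i j. scV (complex_of_real (1 / c)) (A i j))"
  define \<xi>' where "\<xi>' = (\<lambda>i. scH (complex_of_real (sqrt c)) (\<xi> i))"
  show "A' \<in> Msa st n" unfolding A'_def using A by (rule Msa_scale)
  show "\<nu> n A' \<le> 1" unfolding A'_def using c by (subst gauge_scale[OF n A]) auto
  show "elem n A' \<xi>' = elem n A \<xi>"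
    unfolding A'_def \<xi>'_def elem_scale_vectors elem_scale
    using c by (simp add: scW_def)
  show "sqnorm n \<xi>' = c * sqnorm n \<xi>" unfolding \<xi>'_def sqnorm_scale using c by simp
qed

text \<open>Passes from the infimum in \<open>dgauge\<close> back to the inequality that it encodes.
  Boundedness of the finitely many operators keeps the set of admissible \<open>t\<close> nonempty,
  so that its \<open>Inf\<close> carries information.\<close>

lemma form_le_gauge:
  assumes k: "1 \<le> k" and C: "C \<in> Msa st k" and CS: "\<And>i j. C i j \<in> S"
  shows "form k C e \<le> \<nu> k C * sqnorm k e"
proof -
  define T where "T = {t. 0 < t \<and> (\<forall>\<xi>::nat \<Rightarrow> 'h.
       Re (\<Sum>i<k. \<Sum>j<k. ip (\<phi> (C i j) (\<xi> j)) (\<xi> i)) \<le> t * (\<Sum>i<k. Re (ip (\<xi> i) (\<xi> i))))}"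
  have dg: "dgauge ip k (\<lambda>i j. \<phi> (C i j)) = Inf T" by (simp add: dgauge_def T_def)
  have "\<forall>i j. \<exists>K. \<forall>h. hnorm ip (\<phi> (C i j) h) \<le> K * hnorm ip h" using op_bounded CS by blast
  then obtain K where K: "\<And>i j h. hnorm ip (\<phi> (C i j) h) \<le> K i j * hnorm ip h" by metis
  \<comment> \<open>The sum dominates all entries at once, and the extra 1 keeps \<open>t\<close>
    positive.\<close>
  define t where "t = (\<Sum>i<k. \<Sum>j<k. \<bar>K i j\<bar>) + 1"
  have "t \<in> T"
  proof -
    have t: "0 < t" unfolding t_def by (intro add_nonneg_pos sum_nonneg) auto
    have "Re (\<Sum>i<k. \<Sum>j<k. ip (\<phi> (C i j) (\<xi> j)) (\<xi> i)) \<le> t * sqnorm k \<xi>" for \<xi>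
    proof -
      have le: "hnorm ip (\<xi> i) * hnorm ip (\<xi> j) \<le> sqnorm k \<xi>" if "i < k" "j < k" for i j
      proof -
        have *: "(hnorm ip (\<xi> i))\<^sup>2 \<le> sqnorm k \<xi>" if "i < k" for i
          unfolding H.hnorm_square sqnorm_def
          using that by (intro member_le_sum) (auto simp: H.ip_nonneg)
        have "2 * (hnorm ip (\<xi> i) * hnorm ip (\<xi> j)) \<le> (hnorm ip (\<xi> i))\<^sup>2 + (hnorm ip (\<xi> j))\<^sup>2"
          using sum_squares_bound[of "hnorm ip (\<xi> i)" "hnorm ip (\<xi> j)"] by (simp add: mult.assoc)
        then show ?thesis using *[OF that(1)] *[OF that(2)] by linarith
      qed
      have "Re (ip (\<phi> (C i j) (\<xi> j)) (\<xi> i)) \<le> \<bar>K i j\<bar> * sqnorm k \<xi>" if "i < k" "j < k" for i j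
      proof -
        have "Re (ip (\<phi> (C i j) (\<xi> j)) (\<xi> i)) \<le> cmod (ip (\<phi> (C i j) (\<xi> j)) (\<xi> i))"
          by (rule complex_Re_le_cmod)
        also have "\<dots> \<le> hnorm ip (\<phi> (C i j) (\<xi> j)) * hnorm ip (\<xi> i)" by (rule H.cauchy_schwarz)
        also have "\<dots> \<le> (\<bar>K i j\<bar> * hnorm ip (\<xi> j)) * hnorm ip (\<xi> i)"
          by (intro mult_right_mono order_trans[OF K] H.hnorm_nonneg abs_ge_self)
        also have "\<dots> \<le> \<bar>K i j\<bar> * sqnorm k \<xi>"
          using mult_left_mono[OF le[OF that], of "\<bar>K i j\<bar>"] by (simp add: mult_ac)
        finally show ?thesis .
      qed
      then have "Re (\<Sum>i<k. \<Sum>j<k. ip (\<phi> (C i j) (\<xi> j)) (\<xi> i))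
          \<le> (\<Sum>i<k. \<Sum>j<k. \<bar>K i j\<bar> * sqnorm k \<xi>)"
        unfolding Re_sum by (intro sum_mono) auto
      also have "\<dots> \<le> t * sqnorm k \<xi>"
        unfolding t_def using sqnorm_nonneg[of k \<xi>]
        by (simp add: distrib_right sum_distrib_right)
      finally show ?thesis .
    qed
    then show ?thesis using t unfolding T_def sqnorm_def by blast
  qed
  then have ne: "T \<noteq> {}" by blast
  have "Inf T \<le> \<nu> k C"
    using contractive k C CS unfolding cgc_def dg[symmetric] by blast
  moreover have T_le: "form k C e \<le> t * sqnorm k e" if "t \<in> T" for t
    using that unfolding T_def form_def sqnorm_def by blast
  have "form k C e \<le> Inf T * sqnorm k e"
  proof (cases "sqnorm k e = 0")
    case True
    then show ?thesis using T_le[OF \<open>t \<in> T\<close>] by simp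
  next
    case False
    then have pos: "0 < sqnorm k e" using sqnorm_nonneg[of k e] by simp
    have "form k C e / sqnorm k e \<le> Inf T"
    proof (rule cInf_greatest[OF ne])
      fix t assume "t \<in> T"
      from T_le[OF this] show "form k C e / sqnorm k e \<le> t" using pos by (simp add: field_simps)
    qed
    then show ?thesis using pos by (simp add: field_simps)
  qed
  ultimately show ?thesis
    using mult_right_mono[OF _ sqnorm_nonneg[of k e]] by (meson order_trans)
qed

text \<open>
  Since \<open>A\<close> need not have entries in \<open>S\<close>, the vectors \<open>\<xi>\<close> are replaced by linearly independent
  ones, for which the coefficients of the tensor are determined and hence lie in \<open>S\<close>. Orthonormalising
  with respect to \<open>\<Sum> \<langle>h, \<xi> i\<rangle> \<langle>\<xi> i, g\<rangle> + \<epsilon> \<langle>h, g\<rangle>\<close> makes the change of basis contractive while increasing the total squared norm by at most \<open>\<epsilon> (n + m)\<close>.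
\<close>

lemma form_le_sqnorm:
  assumes n: "1 \<le> n" and A: "A \<in> Msa st n" and \<nu>A: "\<nu> n A \<le> 1"
    and m: "1 \<le> m" and B: "B \<in> Msa st m" and BS: "\<And>i j. B i j \<in> S"
    and eq: "elem n A \<xi> = elem m B \<eta>"
  shows "form m B \<eta> \<le> sqnorm n \<xi>"
proof -
  have approx: "form m B \<eta> \<le> sqnorm n \<xi> + \<epsilon> * real (n + m)" if \<epsilon>: "0 < \<epsilon>" for \<epsilon>
  proof -
    \<comment> \<open>The \<open>\<epsilon>\<close> term makes the form definite: without it a
      vector orthogonal to every \<open>\<xi> i\<close>, possibly some \<open>\<eta> j\<close>,
      would have length zero.\<close>
    define ipe where "ipe h g = (\<Sum>i<n. ip h (\<xi> i) * ip (\<xi> i) g) + complex_of_real \<epsilon> * ip h g" for h g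
    have ipe_self: "Re (ipe h h) = (\<Sum>i<n. (cmod (ip (\<xi> i) h))\<^sup>2) + \<epsilon> * Re (ip h h)" for h
    proof -
      have "ip h (\<xi> i) * ip (\<xi> i) h = complex_of_real ((cmod (ip (\<xi> i) h))\<^sup>2)" for i
        unfolding complex_norm_square H.ip_cnj by simp
      then show ?thesis by (simp add: ipe_def)
    qed
    have ipe_ge: "\<epsilon> * Re (ip h h) \<le> Re (ipe h h)" for h
      unfolding ipe_self by (simp add: sum_nonneg)
    have "complex_inner_product scH ipe"
    proof unfold_locales
      show "ipe (x + y) z = ipe x z + ipe y z" for x y z
        by (simp add: ipe_def H.ip_add_left distrib_left distrib_right sum.distrib)
      show "ipe (scH c x) y = c * ipe x y" for c x y
        by (simp add: ipe_def H.ip_scale_left distrib_left sum_distrib_left mult_ac)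
      show "cnj (ipe x y) = ipe y x" for x y
        by (simp add: ipe_def H.ip_cnj mult.commute)
      show "0 \<le> Re (ipe x x)" for x
        using ipe_ge[of x] \<epsilon> H.ip_nonneg[of x] by (meson mult_nonneg_nonneg less_imp_le order_trans)
      show "x = 0" if "ipe x x = 0" for x
        using ipe_ge[of x] \<epsilon> H.ip_nonneg[of x] that H.Re_ip_self_eq_0[of x]
        by (simp add: mult_le_0_iff)
    qed
    then interpret E: complex_inner_product scH ipe .
    obtain k f where k: "k \<le> n + m"
      and onf: "\<And>p q. p < k \<Longrightarrow> q < k \<Longrightarrow> ipe (f p) (f q) = (if p = q then 1 else 0)"
      and span: "\<And>i. i < n + m \<Longrightarrow> cat n \<xi> \<eta> i = (\<Sum>p<k. scH (ipe (cat n \<xi> \<eta> i) (f p)) (f p))"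
      using E.gram_schmidt[of "n + m" "cat n \<xi> \<eta>"] by blast
    \<comment> \<open>\<open>X\<close> is the span of the \<open>f p\<close>, written as the fixed
      points of Fourier expansion so that membership is an equation.\<close>
    define X where "X = {x. (\<Sum>p<k. scH (ipe x (f p)) (f p)) = x}"
    have X\<xi>: "\<xi> i \<in> X" if "i < n" for i using span[of i, symmetric] that by (simp add: X_def cat_def)
    have X\<eta>: "\<eta> i \<in> X" if "i < m" for i using span[of "n + i", symmetric] that by (simp add: X_def cat_def)
    have Xf: "f q \<in> X" if "q < k" for q
    proof -
      have "(\<Sum>p<k. scH (ipe (f q) (f p)) (f p)) = (\<Sum>p<k. if p = q then f p else 0)"
        using that by (intro sum.cong) (auto simp: onf)
      then show ?thesis using that by (simp add: X_def)
    qed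
    have X_add: "x + y \<in> X" if x: "x \<in> X" and y: "y \<in> X" for x y
      using x y by (simp add: X_def E.ip_add_left H.scale_left_distrib sum.distrib)
    have X_scale: "scH c x \<in> X" if x: "x \<in> X" for c x
      using x by (simp add: X_def E.ip_scale_left flip: H.scale_scale H.scale_sum_right)
    have X_sum: "(\<And>i. i \<in> I \<Longrightarrow> g i \<in> X) \<Longrightarrow> sum g I \<in> X" for g and I :: "nat set"
      by (induction I rule: infinite_finite_induct) (auto simp: X_add, auto simp: X_def)
    have X_diff: "x - y \<in> X" if x: "x \<in> X" and y: "y \<in> X" for x y
      using X_add[OF x X_scale[OF y, of "- 1"]] by simp

    \<comment> \<open>\<open>e\<close> is the basis dual to \<open>f\<close> with respect to \<open>ip\<close>.\<close>
    define e where "e q = (\<Sum>i<n. scH (ip (f q) (\<xi> i)) (\<xi> i)) + scH (complex_of_real \<epsilon>) (f q)" for q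
    have ip_e: "ip g (e q) = ipe g (f q)" for g q
      by (simp add: e_def ipe_def H.ip_add_right H.ip_sum_right H.ip_scale_right H.ip_cnj mult.commute)
    have Xe: "e q \<in> X" if "q < k" for q
      unfolding e_def using that X\<xi> Xf by (intro X_add X_sum X_scale) auto
    \<comment> \<open>By duality the error \<open>d\<close> is orthogonal to every
      \<open>f r\<close>; lying in their span, it is orthogonal to itself.\<close>
    have expand: "(\<Sum>q<k. scH (ip y (f q)) (e q)) = y" if y: "y \<in> X" for y
    proof -
      define d where "d = y - (\<Sum>q<k. scH (ip y (f q)) (e q))"
      have ef: "ip (e q) (f r) = (if r = q then 1 else 0)" if "q < k" "r < k" for q r
        using onf[of r q] that ip_e[of "f r" q] H.ip_cnj[of "f r" "e q"] by auto
      have df: "ip d (f r) = 0" if "r < k" for r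
        using that by (simp add: d_def H.ip_diff_left H.ip_sum_left H.ip_scale_left ef if_distrib
            cong: if_cong)
      have "d \<in> X" unfolding d_def using y Xe by (intro X_diff X_sum X_scale) auto
      then have "ip d d = ip d (\<Sum>p<k. scH (ipe d (f p)) (f p))" unfolding X_def by simp
      also have "\<dots> = 0" by (simp add: H.ip_sum_right H.ip_scale_right df)
      finally have "d = 0" by (rule H.ip_definite)
      then show ?thesis by (simp add: d_def)
    qed
    \<comment> \<open>A trace computation: \<open>ip (f q) (e q) = 1\<close> makes each of the
      \<open>k\<close> vectors contribute \<open>\<epsilon>\<close>, and summing the rest over
      \<open>q\<close> first gives Parseval's identity for each \<open>\<xi> i\<close>.\<close>
    have sqnorm_e: "sqnorm k e = sqnorm n \<xi> + \<epsilon> * real k"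
    proof -
      have "(\<Sum>q<k. ip (e q) (e q))
          = (\<Sum>q<k. (\<Sum>i<n. ip (f q) (\<xi> i) * ip (\<xi> i) (e q)) + complex_of_real \<epsilon>)"
      proof (rule sum.cong[OF refl])
        fix q assume "q \<in> {..<k}"
        then have "ip (f q) (e q) = 1" by (simp add: ip_e onf)
        then show "ip (e q) (e q)
            = (\<Sum>i<n. ip (f q) (\<xi> i) * ip (\<xi> i) (e q)) + complex_of_real \<epsilon>"
          by (subst (1) e_def) (simp add: H.ip_add_left H.ip_sum_left H.ip_scale_left)
      qed
      also have "\<dots> = (\<Sum>i<n. \<Sum>q<k. ip (f q) (\<xi> i) * ip (\<xi> i) (e q)) + complex_of_real (\<epsilon> * real k)"
        by (simp add: sum.distrib sum.swap[of _ "{..<n}"])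
      also have "(\<Sum>i<n. \<Sum>q<k. ip (f q) (\<xi> i) * ip (\<xi> i) (e q)) = (\<Sum>i<n. ip (\<xi> i) (\<xi> i))"
      proof (rule sum.cong[OF refl])
        fix i assume "i \<in> {..<n}"
        then have "ip (\<xi> i) (\<xi> i) = ip (\<xi> i) (\<Sum>q<k. scH (ip (\<xi> i) (f q)) (e q))"
          using expand[OF X\<xi>[of i]] by simp
        then show "(\<Sum>q<k. ip (f q) (\<xi> i) * ip (\<xi> i) (e q)) = ip (\<xi> i) (\<xi> i)"
          by (simp add: H.ip_sum_right H.ip_scale_right H.ip_cnj)
      qed
      finally have "Re (\<Sum>q<k. ip (e q) (e q)) = Re ((\<Sum>i<n. ip (\<xi> i) (\<xi> i)) + complex_of_real (\<epsilon> * real k))"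
        by (rule arg_cong)
      then show ?thesis by (simp add: sqnorm_def)
    qed
    define Z where "Z i p = ip (\<xi> i) (f p)" for i p
    \<comment> \<open>Evaluating the tensor at the pairs \<open>(f p, f q)\<close> reads off its
      coefficients in the basis \<open>e\<close>. They form a compression of \<open>A\<close> and,
      by \<open>eq\<close>, are also combinations of entries of \<open>B\<close>, hence lie in
      \<open>S\<close>.\<close>
    define C where "C = compress scV n k Z A"
    have C_A: "C p q = elem n A \<xi> (f p) (f q)" if "p < k" "q < k" for p q
      using that by (simp add: C_def compress_def elem_def Z_def H.ip_cnj)
    have C_B: "C p q = elem m B \<eta> (f p) (f q)" if "p < k" "q < k" for p q
      using C_A[OF that] eq by simp
    have C_outside: "C p q = 0" if "k \<le> p \<or> k \<le> q" for p q
      using that by (auto simp: C_def compress_def)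
    have CS: "C p q \<in> S" for p q
    proof (cases "p < k \<and> q < k")
      case True
      then show ?thesis by (simp add: C_B elem_def) (intro S_sum S_scale BS)
    next
      case False
      then show ?thesis using C_outside[of p q] S_zero by (simp add: not_less)
    qed
    have C: "C \<in> Msa st k"
    proof (rule MsaI)
      show "C i j = 0" if "k \<le> i \<or> k \<le> j" for i j using C_outside that .
      show "st (C i j) = C j i" if "i < k" "j < k" for i j
        using that by (simp add: C_A elem_def st_sum st_scale Msa_st[OF A] H.ip_cnj mult.commute)
          (rule sum.swap)
    qed
    show ?thesis
    \<comment> \<open>The compression axiom concerns sizes at least 1, so the case in which all
      vectors vanish is separate.\<close>
    proof (cases "k = 0")
      case True
      then have "\<eta> j = 0" if "j < m" for j using X\<eta>[OF that] by (auto simp: X_def)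
      then have "form m B \<eta> = 0" by (simp add: form_def)
      then show ?thesis using sqnorm_nonneg[of n \<xi>] \<epsilon> by simp
    next
      case False
      then have k1: "1 \<le> k" by simp
      \<comment> \<open>The image of \<open>c\<close> under \<open>Z\<close> has coordinates
        \<open>ip (\<xi> i) g\<close>. Their squared moduli are one part of \<open>ipe g g\<close>,
        which orthonormality of \<open>f\<close> identifies with the squared length of
        \<open>c\<close>.\<close>
      have "(cmat_norm n k Z)\<^sup>2 \<le> 1"
      proof (rule cmat_norm_square_le_1)
        fix c :: "nat \<Rightarrow> complex"
        define g where "g = (\<Sum>j<k. scH (cnj (c j)) (f j))"
        have "(\<Sum>j<k. Z i j * c j) = ip (\<xi> i) g" for i
          by (simp add: g_def Z_def H.ip_sum_right H.ip_scale_right mult.commute)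
        then have "(\<Sum>i<n. (cmod (\<Sum>j<k. Z i j * c j))\<^sup>2) \<le> Re (ipe g g)"
          using \<epsilon> H.ip_nonneg[of g] by (simp add: ipe_self)
        also have "ipe g g = (\<Sum>j<k. c j * cnj (c j))"
          by (simp add: g_def E.ip_sum_left E.ip_sum_right E.ip_scale_left E.ip_scale_right onf
              if_distrib cong: if_cong)
        also have "\<dots> = complex_of_real (\<Sum>j<k. (cmod (c j))\<^sup>2)"
          unfolding of_real_sum complex_norm_square by simp
        finally show "(\<Sum>i<n. (cmod (\<Sum>j<k. Z i j * c j))\<^sup>2) \<le> (\<Sum>j<k. (cmod (c j))\<^sup>2)" by simp
      qed
      then have "(cmat_norm n k Z)\<^sup>2 * \<nu> n A \<le> 1 * 1"
        using \<nu>A gauge_nonneg[OF n A] by (intro mult_mono) auto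
      then have \<nu>C: "\<nu> k C \<le> 1" using gauge_compress[OF n k1 A, of Z] by (simp add: C_def)
      \<comment> \<open>Expanding \<open>\<eta>\<close> in the basis \<open>e\<close> and collecting
        coefficients inside \<open>\<phi>\<close> turns the form of \<open>B\<close> into the form
        of \<open>C\<close>.\<close>
      have "ip (\<phi> (B i j) (\<eta> j)) (\<eta> i) = (\<Sum>p<k. \<Sum>q<k.
          ip (f p) (\<eta> i) * ip (\<eta> j) (f q) * ip (\<phi> (B i j) (e q)) (e p))" if "i < m" "j < m" for i j
      proof -
        have "ip (\<phi> (B i j) (\<eta> j)) (\<eta> i)
            = ip (\<phi> (B i j) (\<Sum>q<k. scH (ip (\<eta> j) (f q)) (e q))) (\<Sum>p<k. scH (ip (\<eta> i) (f p)) (e p))"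
          using expand[OF X\<eta>[OF that(1)]] expand[OF X\<eta>[OF that(2)]] by simp
        also have "\<dots> = (\<Sum>p<k. \<Sum>q<k.
            ip (f p) (\<eta> i) * ip (\<eta> j) (f q) * ip (\<phi> (B i j) (e q)) (e p))"
          by (simp add: op_sum op_scale BS H.ip_sum_left H.ip_sum_right H.ip_scale_left
              H.ip_scale_right H.ip_cnj sum_distrib_left mult_ac)
        finally show ?thesis .
      qed
      then have "(\<Sum>i<m. \<Sum>j<m. ip (\<phi> (B i j) (\<eta> j)) (\<eta> i)) = (\<Sum>i<m. \<Sum>j<m. \<Sum>p<k. \<Sum>q<k.
          ip (f p) (\<eta> i) * ip (\<eta> j) (f q) * ip (\<phi> (B i j) (e q)) (e p))" by simp
      also have "\<dots> = (\<Sum>p<k. \<Sum>q<k. \<Sum>i<m. \<Sum>j<m.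
          ip (f p) (\<eta> i) * ip (\<eta> j) (f q) * ip (\<phi> (B i j) (e q)) (e p))" by (rule sum_swap4)
      also have "\<dots> = (\<Sum>p<k. \<Sum>q<k. ip (\<phi> (C p q) (e q)) (e p))"
        by (intro sum.cong refl) (simp add: C_B elem_def map_sum map_scale S_sum S_scale BS
            H.ip_sum_left H.ip_scale_left)
      finally have "form m B \<eta> = form k C e" by (simp add: form_def)
      also have "\<dots> \<le> \<nu> k C * sqnorm k e" using form_le_gauge[OF k1 C CS] .
      also have "\<dots> \<le> sqnorm k e"
        using mult_right_mono[OF \<nu>C sqnorm_nonneg[of k e]] by simp
      also have "\<dots> \<le> sqnorm n \<xi> + \<epsilon> * real (n + m)"
        unfolding sqnorm_e using k \<epsilon> by (intro add_left_mono mult_left_mono) auto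
      finally show ?thesis .
    qed
  qed
  \<comment> \<open>The basis varies with \<open>\<epsilon>\<close>, but
    \<open>k \<le> n + m\<close> gives an error bound independent of it.\<close>
  show ?thesis
  proof (rule field_le_epsilon)
    fix \<delta> :: real assume \<delta>: "0 < \<delta>"
    have "form m B \<eta> \<le> sqnorm n \<xi> + \<delta> / real (n + m) * real (n + m)"
      using n \<delta> by (intro approx) auto
    then show "form m B \<eta> \<le> sqnorm n \<xi> + \<delta>" using n by simp
  qed
qed

section \<open>The dominated functional\<close>

definition sa_tensors :: "('h \<Rightarrow> 'h \<Rightarrow> 'v) set" where
  "sa_tensors = {elem n A \<xi> | n A \<xi>. 1 \<le> n \<and> A \<in> Msa st n}"

lemma elem_in_sa_tensors: "1 \<le> n \<Longrightarrow> A \<in> Msa st n \<Longrightarrow> elem n A \<xi> \<in> sa_tensors"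
  unfolding sa_tensors_def by blast

lemma sa_tensors_zero: "0 \<in> sa_tensors"
  using elem_in_sa_tensors[of 1, OF _ Msa_zero] by (simp add: elem_zero)

lemma sa_tensors_add: assumes "u \<in> sa_tensors" "v \<in> sa_tensors" shows "u + v \<in> sa_tensors"
proof -
  obtain n A \<xi> m B \<eta> where "1 \<le> n" "A \<in> Msa st n" "u = elem n A \<xi>" "1 \<le> m" "B \<in> Msa st m" "v = elem m B \<eta>"
    using assms unfolding sa_tensors_def by blast
  then show ?thesis
    using elem_in_sa_tensors[of "n + m" "dsum n A B" "cat n \<xi> \<eta>"] by (simp add: elem_cat Msa_dsum)
qed

lemma sa_tensors_sum: "(\<And>i. i \<in> I \<Longrightarrow> f i \<in> sa_tensors) \<Longrightarrow> sum f I \<in> sa_tensors"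
  by (induction I rule: infinite_finite_induct) (auto simp: sa_tensors_zero sa_tensors_add)

text \<open>Over a fixed \<open>u\<close> the infimum of the second component is the infimal
  convolution of the gauge bound with the functional of \<open>\<phi>\<close>. Normalising to
  \<open>\<nu> n A \<le> 1\<close> makes the set additive: a direct sum keeps the gauge at most 1
  while squared norms add, whereas products of gauge and squared norm would not add.\<close>

definition costs :: "(('h \<Rightarrow> 'h \<Rightarrow> 'v) \<times> real) set" where
  "costs = {(elem n A \<xi> + elem m B \<eta>, sqnorm n \<xi> + form m B \<eta>) | n A \<xi> m B \<eta>.
     1 \<le> n \<and> A \<in> Msa st n \<and> \<nu> n A \<le> 1 \<and> 1 \<le> m \<and> B \<in> Msa st m \<and> (\<forall>i j. B i j \<in> S)}"

lemma costsI:
  assumes "1 \<le> n" "A \<in> Msa st n" "\<nu> n A \<le> 1" "1 \<le> m" "B \<in> Msa st m" "\<And>i j. B i j \<in> S"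
    and "u = elem n A \<xi> + elem m B \<eta>" "c = sqnorm n \<xi> + form m B \<eta>"
  shows "(u, c) \<in> costs"
  using assms unfolding costs_def by blast

lemma costsE:
  assumes "(u, c) \<in> costs"
  obtains n A m B \<xi> \<eta> where "1 \<le> n" "A \<in> Msa st n" "\<nu> n A \<le> 1" "1 \<le> m" "B \<in> Msa st m"
    "\<forall>i j. B i j \<in> S" "u = elem n A \<xi> + elem m B \<eta>" "c = sqnorm n \<xi> + form m B \<eta>"
  using assms unfolding costs_def by blast

lemma costs_gauge:
  assumes n: "1 \<le> n" and A: "A \<in> Msa st n" and c: "0 < c" "\<nu> n A \<le> c"
  shows "(elem n A \<xi>, c * sqnorm n \<xi>) \<in> costs"
proof -
  obtain A' \<xi>' where "A' \<in> Msa st n" "\<nu> n A' \<le> 1" "elem n A' \<xi>' = elem n A \<xi>"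
    "sqnorm n \<xi>' = c * sqnorm n \<xi>" using elem_normalise[OF n A c] .
  then show ?thesis
    by (intro costsI[of n A' 1 "\<lambda>i j. 0" _ \<xi>' "\<lambda>i. 0"])
      (use n in \<open>simp_all add: Msa_zero S_zero elem_zero form_zero\<close>)
qed

lemma costs_form:
  assumes m: "1 \<le> m" and B: "B \<in> Msa st m" and BS: "\<And>i j. B i j \<in> S"
  shows "(elem m B \<eta>, form m B \<eta>) \<in> costs"
  by (rule costsI[of 1 "\<lambda>i j. 0" m B _ "\<lambda>i. 0" \<eta>])
    (use m B BS in \<open>simp_all add: Msa_zero gauge_zero elem_zero sqnorm_def\<close>)

lemma sa_tensors_subset_costs: "sa_tensors \<subseteq> fst ` costs"
proof
  fix u assume "u \<in> sa_tensors"
  then obtain n A \<xi> where u: "1 \<le> n" "A \<in> Msa st n" "u = elem n A \<xi>" unfolding sa_tensors_def by blast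
  then have "(u, (\<nu> n A + 1) * sqnorm n \<xi>) \<in> costs"
    using gauge_nonneg[of n A] by (auto intro!: costs_gauge)
  then show "u \<in> fst ` costs" by force
qed

lemma costs_fst_sa_tensors: "(u, c) \<in> costs \<Longrightarrow> u \<in> sa_tensors"
  by (erule costsE) (blast intro: sa_tensors_add elem_in_sa_tensors)

lemma S_dsum: "(\<And>i j. A i j \<in> S) \<Longrightarrow> (\<And>i j. B i j \<in> S) \<Longrightarrow> dsum n A B i j \<in> S"
  by (simp add: dsum_def S_zero)

lemma dominated_functional:
  obtains F where "\<And>u v. u \<in> sa_tensors \<Longrightarrow> v \<in> sa_tensors \<Longrightarrow> F (u + v) = F u + F v"
    and "\<And>t u. u \<in> sa_tensors \<Longrightarrow> F (scW t u) = t * F u"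
    and "\<And>u c. (u, c) \<in> costs \<Longrightarrow> F u \<le> c"
proof -
  have "\<exists>F. (\<forall>u\<in>fst ` costs. \<forall>v\<in>fst ` costs. F (u + v) = F u + F v) \<and>
      (\<forall>t. \<forall>u\<in>fst ` costs. F (scW t u) = t * F u) \<and> (\<forall>u c. (u, c) \<in> costs \<longrightarrow> F u \<le> c)"
  proof (rule cone_dominates_linear_functional[OF module_scW])
    show "(0, 0) \<in> costs"
      using costs_form[of 1 "\<lambda>i j. 0" "\<lambda>i. 0"] by (simp add: Msa_zero S_zero elem_zero form_zero)
    show "(u + v, c + d) \<in> costs" if u: "(u, c) \<in> costs" and v: "(v, d) \<in> costs" for u c v d
    proof -
      obtain n A m B \<xi> \<eta> where 1: "1 \<le> n" "A \<in> Msa st n" "\<nu> n A \<le> 1" "1 \<le> m" "B \<in> Msa st m"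
        "\<forall>i j. B i j \<in> S" "u = elem n A \<xi> + elem m B \<eta>" "c = sqnorm n \<xi> + form m B \<eta>"
        using costsE[OF u] .
      obtain n' A' m' B' \<xi>' \<eta>' where 2: "1 \<le> n'" "A' \<in> Msa st n'" "\<nu> n' A' \<le> 1" "1 \<le> m'"
        "B' \<in> Msa st m'" "\<forall>i j. B' i j \<in> S" "v = elem n' A' \<xi>' + elem m' B' \<eta>'"
        "d = sqnorm n' \<xi>' + form m' B' \<eta>'"
        using costsE[OF v] .
      show ?thesis
      proof (rule costsI)
        show "1 \<le> n + n'" "1 \<le> m + m'" using 1(1,4) by simp_all
        show "dsum n A A' \<in> Msa st (n + n')" using Msa_dsum[OF 1(2) 2(2)] .
        show "\<nu> (n + n') (dsum n A A') \<le> 1"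
          unfolding gauge_dsum[OF 1(1) 2(1) 1(2) 2(2)] using 1(3) 2(3) by simp
        show "dsum m B B' \<in> Msa st (m + m')" using Msa_dsum[OF 1(5) 2(5)] .
        show "dsum m B B' i j \<in> S" for i j using S_dsum[OF 1(6)[rule_format] 2(6)[rule_format]] .
        show "u + v = elem (n + n') (dsum n A A') (cat n \<xi> \<xi>') + elem (m + m') (dsum m B B') (cat m \<eta> \<eta>')"
          unfolding elem_cat 1(7) 2(7) by (simp only: add_ac)
        show "c + d = sqnorm (n + n') (cat n \<xi> \<xi>') + form (m + m') (dsum m B B') (cat m \<eta> \<eta>')"
          unfolding sqnorm_cat form_cat 1(8) 2(8) by simp
      qed
    qed
    show "(scW t u, t * c) \<in> costs" if u: "(u, c) \<in> costs" and t: "0 < t" for u c t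
    proof -
      obtain n A m B \<xi> \<eta> where 1: "1 \<le> n" "A \<in> Msa st n" "\<nu> n A \<le> 1" "1 \<le> m" "B \<in> Msa st m"
        "\<forall>i j. B i j \<in> S" "u = elem n A \<xi> + elem m B \<eta>" "c = sqnorm n \<xi> + form m B \<eta>"
        using costsE[OF u] .
      \<comment> \<open>The factor goes into the vectors in the first summand, to preserve
        \<open>\<nu> n A \<le> 1\<close>, and into the matrix in the second, whose entries stay in
        \<open>S\<close>.\<close>
      have "scW t u = elem n A (\<lambda>i. scH (complex_of_real (sqrt t)) (\<xi> i))
          + elem m (\<lambda>i j. scV (complex_of_real t) (B i j)) \<eta>"
        unfolding elem_scale elem_scale_vectors 1(7) using t
        by (simp add: scW_def fun_eq_iff V.scale_right_distrib)
      moreover have "t * c = sqnorm n (\<lambda>i. scH (complex_of_real (sqrt t)) (\<xi> i))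
          + form m (\<lambda>i j. scV (complex_of_real t) (B i j)) \<eta>"
        unfolding sqnorm_scale form_scale[OF 1(6)[rule_format]] 1(8) using t by (simp add: distrib_left)
      ultimately show ?thesis
        by (rule costsI[OF 1(1-4) Msa_scale[OF 1(5)] S_scale[OF 1(6)[rule_format]]])
    qed
    show "\<exists>d. (- u, d) \<in> costs" if uc: "(u, c) \<in> costs" for u c
    proof -
      obtain n A \<xi> where u: "1 \<le> n" "A \<in> Msa st n" "u = elem n A \<xi>"
        using costs_fst_sa_tensors[OF uc] unfolding sa_tensors_def by blast
      then have "- u \<in> sa_tensors" using elem_in_sa_tensors[OF u(1) Msa_minus[OF u(2)], of \<xi>] by (simp add: elem_minus)
      then show ?thesis using sa_tensors_subset_costs by force
    qed
    \<comment> \<open>A vanishing sum says that \<open>A\<close> over \<open>V\<close> and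
      \<open>- B\<close> over \<open>S\<close> represent the same tensor, so consistency of the cone
      is exactly the domination inequality for \<open>- B\<close>.\<close>
    show "0 \<le> c" if zc: "(0, c) \<in> costs" for c
    proof -
      obtain n A m B \<xi> \<eta> where 1: "1 \<le> n" "A \<in> Msa st n" "\<nu> n A \<le> 1" "1 \<le> m" "B \<in> Msa st m"
        "\<forall>i j. B i j \<in> S" "0 = elem n A \<xi> + elem m B \<eta>" "c = sqnorm n \<xi> + form m B \<eta>"
        using costsE[OF zc] .
      have "elem n A \<xi> = elem m (\<lambda>i j. - B i j) \<eta>"
        unfolding elem_minus using 1(7) by (simp add: eq_neg_iff_add_eq_0)
      from form_le_sqnorm[OF 1(1-4) Msa_minus[OF 1(5)] S_minus[OF 1(6)[rule_format]] this]
      have "form m (\<lambda>i j. - B i j) \<eta> \<le> sqnorm n \<xi>" .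
      then show ?thesis using 1(8) by (simp add: form_minus[OF 1(6)[rule_format]])
    qed
  qed
  then obtain F where F: "\<forall>u\<in>fst ` costs. \<forall>v\<in>fst ` costs. F (u + v) = F u + F v"
    "\<forall>t. \<forall>u\<in>fst ` costs. F (scW t u) = t * F u" "\<forall>u c. (u, c) \<in> costs \<longrightarrow> F u \<le> c" by (elim exE conjE)
  show thesis
  proof (rule that)
    show "F (u + v) = F u + F v" if "u \<in> sa_tensors" "v \<in> sa_tensors" for u v
      using bspec[OF bspec[OF F(1) subsetD[OF sa_tensors_subset_costs that(1)]] subsetD[OF sa_tensors_subset_costs that(2)]] .
    show "F (scW t u) = t * F u" if "u \<in> sa_tensors" for t u
      using F(2)[THEN spec] subsetD[OF sa_tensors_subset_costs that] by (rule bspec)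
    show "F u \<le> c" if "(u, c) \<in> costs" for u c
      using F(3)[rule_format, OF that] .
  qed
qed

section \<open>The extension\<close>

text \<open>
  \<open>tensor v h g\<close> is \<open>v \<otimes> h \<otimes> cnj g\<close> plus its adjoint, i.e. twice its real part.
\<close>

definition tensor :: "'v \<Rightarrow> 'h \<Rightarrow> 'h \<Rightarrow> 'h \<Rightarrow> 'h \<Rightarrow> 'v" where
  "tensor v h g = (\<lambda>a b. scV (ip a g * ip h b) v + scV (ip a h * ip g b) (st v))"

text \<open>The self-adjoint two-by-two dilation of \<open>v\<close>, which gives access to the
  gauges for elements that are not self-adjoint.\<close>

definition offdiag :: "'v \<Rightarrow> nat \<Rightarrow> nat \<Rightarrow> 'v" where
  "offdiag v = (\<lambda>i j. if i = 0 \<and> j = 1 then v else if i = 1 \<and> j = 0 then st v else 0)"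

definition pair :: "'h \<Rightarrow> 'h \<Rightarrow> nat \<Rightarrow> 'h" where
  "pair g h = (\<lambda>i. if i = 0 then g else h)"

lemma offdiag_Msa: "offdiag v \<in> Msa st 2"
  by (rule MsaI) (auto simp: offdiag_def)

lemma tensor_eq_elem: "tensor v h g = elem 2 (offdiag v) (pair g h)"
  by (simp add: tensor_def elem_def offdiag_def pair_def numeral_2_eq_2 fun_eq_iff)

lemma tensor_in_sa_tensors: "tensor v h g \<in> sa_tensors"
  unfolding tensor_eq_elem by (simp add: elem_in_sa_tensors offdiag_Msa)

lemma sqnorm_pair: "sqnorm 2 (pair g h) = (hnorm ip g)\<^sup>2 + (hnorm ip h)\<^sup>2"
  unfolding H.hnorm_square by (simp add: sqnorm_def pair_def numeral_2_eq_2)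

lemma tensor_add: "tensor (v + w) h g = tensor v h g + tensor w h g"
  by (simp add: tensor_def fun_eq_iff st_add V.scale_right_distrib)

lemma tensor_add_left: "tensor v (h + h') g = tensor v h g + tensor v h' g"
  by (simp add: tensor_def fun_eq_iff H.ip_add_left H.ip_add_right distrib_left distrib_right
      V.scale_left_distrib)

lemma tensor_add_right: "tensor v h (g + g') = tensor v h g + tensor v h g'"
  by (simp add: tensor_def fun_eq_iff H.ip_add_left H.ip_add_right distrib_left distrib_right
      V.scale_left_distrib)

text \<open>Scalars on a vector move to \<open>v\<close>, so homogeneity in the vectors reduces to
  homogeneity in \<open>v\<close>.\<close>

lemma tensor_scale_left: "tensor v (scH c h) g = tensor (scV c v) h g"
  by (simp add: tensor_def fun_eq_iff H.ip_scale_left H.ip_scale_right st_scale mult_ac)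

lemma tensor_scale_right: "tensor v h (scH c g) = tensor (scV (cnj c) v) h g"
  by (simp add: tensor_def fun_eq_iff H.ip_scale_left H.ip_scale_right st_scale mult_ac)

lemma tensor_real: "tensor (scV (complex_of_real t) v) h g = scW t (tensor v h g)"
  by (simp add: tensor_def scW_def fun_eq_iff st_scale V.scale_right_distrib mult_ac)

lemma tensor_st: "tensor (st v) h g = tensor v g h"
  by (simp add: tensor_def fun_eq_iff add.commute)

text \<open>Since \<open>A\<close> is self-adjoint, the adjoint halves of the summands are the
  direct halves with \<open>i\<close> and \<open>j\<close> exchanged, hence the factor 2.\<close>

lemma sum_tensor:
  assumes "A \<in> Msa st n"
  shows "(\<Sum>i<n. \<Sum>j<n. tensor (A i j) (\<xi> j) (\<xi> i)) = scW 2 (elem n A \<xi>)"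
proof (intro ext)
  fix a b
  have apply_sum: "sum f I a b = (\<Sum>i\<in>I. f i a b)" for f :: "nat \<Rightarrow> 'h \<Rightarrow> 'h \<Rightarrow> 'v" and I
    by (induction I rule: infinite_finite_induct) auto
  have "(\<Sum>i<n. \<Sum>j<n. scV (ip a (\<xi> j) * ip (\<xi> i) b) (A j i)) = elem n A \<xi> a b"
    unfolding elem_def by (rule sum.swap)
  then have "(\<Sum>i<n. \<Sum>j<n. tensor (A i j) (\<xi> j) (\<xi> i)) a b = elem n A \<xi> a b + elem n A \<xi> a b"
    by (simp add: apply_sum tensor_def sum.distrib Msa_st[OF assms]) (simp add: elem_def)
  also have "\<dots> = scW 2 (elem n A \<xi>) a b"
    using V.scale_left_distrib[of 1 1 "elem n A \<xi> a b"] by (simp add: scW_def)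
  finally show "(\<Sum>i<n. \<Sum>j<n. tensor (A i j) (\<xi> j) (\<xi> i)) a b = scW 2 (elem n A \<xi>) a b" .
qed

text \<open>For fixed \<open>h\<close> the form is conjugate-linear in \<open>g\<close>, so the
  Riesz theorem is applied to its conjugate.\<close>

lemma bounded_sesquilinear_form_represented:
  assumes add_l: "\<And>h h' g. \<beta> (h + h') g = \<beta> h g + \<beta> h' g"
    and scale_l: "\<And>c h g. \<beta> (scH c h) g = c * \<beta> h g"
    and add_r: "\<And>h g g'. \<beta> h (g + g') = \<beta> h g + \<beta> h g'"
    and scale_r: "\<And>c h g. \<beta> h (scH c g) = cnj c * \<beta> h g"
    and bound: "\<And>h g. cmod (\<beta> h g) \<le> K * hnorm ip h * hnorm ip g"
  shows "\<exists>T. bounded_op scH ip T \<and> (\<forall>h g. ip (T h) g = \<beta> h g)"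
proof -
  have "\<exists>y. \<forall>g. cnj (\<beta> h g) = ip g y" for h
  proof (rule H.riesz_representation)
    fix u :: "nat \<Rightarrow> 'h"
    show "\<exists>l. \<forall>e>0. \<exists>N. \<forall>n\<ge>N. hnorm ip (u n - l) < e"
      if "\<forall>e>0. \<exists>N. \<forall>m\<ge>N. \<forall>n\<ge>N. hnorm ip (u m - u n) < e"
      using hilbert that unfolding hilbert_space_def by blast
  next
    show "cmod (cnj (\<beta> h g)) \<le> (K * hnorm ip h) * hnorm ip g" for g using bound by simp
  qed (simp_all add: add_r scale_r)
  then obtain T where T: "\<And>h g. cnj (\<beta> h g) = ip g (T h)" by metis
  have \<beta>: "ip (T h) g = \<beta> h g" for h g
    using T[of h g] H.ip_cnj[of g "T h"] by (metis complex_cnj_cnj)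
  have "T (h + h') = T h + T h'" for h h'
    by (rule H.ip_left_cancel) (simp add: \<beta> H.ip_add_left add_l)
  moreover have "T (scH c h) = scH c (T h)" for c h
    by (rule H.ip_left_cancel) (simp add: \<beta> H.ip_scale_left scale_l)
  moreover have "hnorm ip (T h) \<le> K * hnorm ip h" for h
  proof (cases "T h = 0")
    case True
    \<comment> \<open>The sign comes from the bound at \<open>(h, h)\<close>, which dominates a
      modulus.\<close>
    have "0 \<le> K * hnorm ip h"
    proof (cases "h = 0")
      case True
      then show ?thesis by (simp add: hnorm_def)
    next
      case False
      then have "0 < hnorm ip h" using H.hnorm_eq_0[of h] H.hnorm_nonneg[of h] by linarith
      moreover have "0 \<le> K * hnorm ip h * hnorm ip h" using bound[of h h] norm_ge_zero order_trans by blast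
      ultimately show ?thesis by (simp add: zero_le_mult_iff)
    qed
    then show ?thesis using True by (simp add: hnorm_def)
  next
    case False
    then have pos: "0 < hnorm ip (T h)" using H.hnorm_eq_0[of "T h"] H.hnorm_nonneg[of "T h"] by linarith
    have "(hnorm ip (T h))\<^sup>2 \<le> cmod (\<beta> h (T h))"
      unfolding H.hnorm_square \<beta>[symmetric] by (rule complex_Re_le_cmod)
    also have "\<dots> \<le> K * hnorm ip h * hnorm ip (T h)" by (rule bound)
    finally show ?thesis using pos by (simp add: power2_eq_square)
  qed
  ultimately show ?thesis using \<beta> unfolding bounded_op_def by (intro exI[of _ T]) blast
qed

lemma gauge_contractive_extension:
  "\<exists>\<psi>. (\<forall>x\<in>S. \<psi> x = \<phi> x) \<and> linear_into_BH scV UNIV scH ip \<psi> \<and> cgc st \<nu> UNIV ip \<psi>"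
proof -
  obtain F where F_add: "\<And>u v. u \<in> sa_tensors \<Longrightarrow> v \<in> sa_tensors \<Longrightarrow> F (u + v) = F u + F v"
    and F_scale: "\<And>t u. u \<in> sa_tensors \<Longrightarrow> F (scW t u) = t * F u"
    and F_le: "\<And>u c. (u, c) \<in> costs \<Longrightarrow> F u \<le> c"
    using dominated_functional by metis
  have F_gauge: "F (elem n A \<xi>) \<le> c * sqnorm n \<xi>"
    if "1 \<le> n" "A \<in> Msa st n" "0 < c" "\<nu> n A \<le> c" for n A \<xi> c
    using F_le[OF costs_gauge[OF that]] .
  have F_zero: "F 0 = 0" using F_add[OF sa_tensors_zero sa_tensors_zero] by simp
  have F_sum: "(\<And>i. i \<in> I \<Longrightarrow> u i \<in> sa_tensors) \<Longrightarrow> F (sum u I) = (\<Sum>i\<in>I. F (u i))" for u and I :: "nat set"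
    by (induction I rule: infinite_finite_induct) (auto simp: F_zero F_add sa_tensors_sum)
  \<comment> \<open>Domination at both \<open>B\<close> and \<open>- B\<close> pins down the
    value.\<close>
  have F_form: "F (elem m B \<eta>) = form m B \<eta>"
    if B: "1 \<le> m" "B \<in> Msa st m" "\<And>i j. B i j \<in> S" for m B \<eta>
  proof (rule antisym)
    show "F (elem m B \<eta>) \<le> form m B \<eta>" using F_le[OF costs_form[OF B]] .
    have "F (elem m (\<lambda>i j. - B i j) \<eta>) \<le> form m (\<lambda>i j. - B i j) \<eta>"
      using B by (intro F_le costs_form Msa_minus S_minus)
    moreover have "F (elem m (\<lambda>i j. - B i j) \<eta>) = - F (elem m B \<eta>)"
      using F_add[OF elem_in_sa_tensors[OF B(1,2)] elem_in_sa_tensors[OF B(1) Msa_minus[OF B(2)]], of \<eta> \<eta>]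
      by (simp add: elem_minus F_zero)
    ultimately show "form m B \<eta> \<le> F (elem m B \<eta>)" by (simp add: form_minus[OF B(3)])
  qed
  define b where "b v h g = F (tensor v h g) / 2" for v h g
  \<comment> \<open>A complex functional \<open>f\<close> is recovered from its real part by
    \<open>f v = Re (f v) - \<i> * Re (f (\<i> * v))\<close>.\<close>
  define \<beta> where "\<beta> v h g = Complex (b v h g) (- b (scV \<i> v) h g)" for v h g
  have b_add: "b (v + w) h g = b v h g + b w h g" for v w h g
    by (simp add: b_def tensor_add F_add tensor_in_sa_tensors add_divide_distrib)
  have b_real: "b (scV (complex_of_real t) v) h g = t * b v h g" for t v h g
    by (simp add: b_def tensor_real F_scale tensor_in_sa_tensors)
  have b_scale: "b (scV c v) h g = Re c * b v h g + Im c * b (scV \<i> v) h g" for c v h g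
  proof -
    have "scV c v = scV (complex_of_real (Re c)) v + scV (complex_of_real (Im c)) (scV \<i> v)"
      by (simp add: complex_eq[of c, symmetric] mult.commute flip: V.scale_left_distrib)
    then show ?thesis by (simp only: b_add b_real)
  qed
  have \<beta>_add: "\<beta> (v + w) h g = \<beta> v h g + \<beta> w h g" for v w h g
    by (simp add: \<beta>_def b_add V.scale_right_distrib complex_eq_iff)
  have \<beta>_scale: "\<beta> (scV c v) h g = c * \<beta> v h g" for c v h g
    using b_scale[of c v h g] b_scale[of "\<i> * c" v h g]
    by (simp add: \<beta>_def complex_eq_iff)
  have \<beta>_add_left: "\<beta> v (h + h') g = \<beta> v h g + \<beta> v h' g" for v h h' g
    by (simp add: \<beta>_def b_def tensor_add_left F_add tensor_in_sa_tensors add_divide_distrib complex_eq_iff)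
  have \<beta>_add_right: "\<beta> v h (g + g') = \<beta> v h g + \<beta> v h g'" for v h g g'
    by (simp add: \<beta>_def b_def tensor_add_right F_add tensor_in_sa_tensors add_divide_distrib complex_eq_iff)
  have \<beta>_scale_left: "\<beta> v (scH c h) g = c * \<beta> v h g" for c v h g
    using \<beta>_scale[of c v h g] by (simp add: \<beta>_def b_def tensor_scale_left mult.commute)
  have \<beta>_scale_right: "\<beta> v h (scH c g) = cnj c * \<beta> v h g" for c v h g
    using \<beta>_scale[of "cnj c" v h g] by (simp add: \<beta>_def b_def tensor_scale_right mult.commute)
  \<comment> \<open>Replacing \<open>v\<close> by its adjoint exchanges the vectors in
    \<open>tensor\<close>, and conjugate-linearity of \<open>st\<close> flips the sign of the
    imaginary part.\<close>
  have \<beta>_st: "\<beta> (st v) h g = cnj (\<beta> v g h)" for v h g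
  proof -
    have "scV \<i> (st v) = st (scV (- \<i>) v)" unfolding st_scale by simp
    then have "b (scV \<i> (st v)) h g = b (scV (- \<i>) v) g h" by (simp add: b_def tensor_st)
    also have "\<dots> = - b (scV \<i> v) g h" using b_scale[of "- \<i>" v g h] by simp
    finally show ?thesis by (simp add: \<beta>_def b_def tensor_st complex_eq_iff)
  qed
  have b_le: "b v h g \<le> (\<nu> 2 (offdiag v) + 1) * hnorm ip h * hnorm ip g" for v h g
  proof (cases "h = 0 \<or> g = 0")
    case True
    have "tensor v h g = 0" using True by (auto simp: tensor_def fun_eq_iff)
    then show ?thesis using True by (auto simp: b_def F_zero hnorm_def)
  next
    case False
    \<comment> \<open>The extra 1 keeps \<open>c\<close> positive when the gauge is 0.\<close>
    define c where "c = \<nu> 2 (offdiag v) + 1"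
    have c: "0 < c" "\<nu> 2 (offdiag v) \<le> c"
      using gauge_nonneg[OF _ offdiag_Msa[of v]] by (auto simp: c_def)
    have pos: "0 < hnorm ip h" "0 < hnorm ip g"
      using False H.hnorm_eq_0[of h] H.hnorm_nonneg[of h] H.hnorm_eq_0[of g] H.hnorm_nonneg[of g]
      by auto
    \<comment> \<open>Rescaling \<open>h\<close> and \<open>g\<close> to equal norms turns \<open>\<parallel>h\<parallel>\<^sup>2 + \<parallel>g\<parallel>\<^sup>2\<close> into \<open>2 \<parallel>h\<parallel> \<parallel>g\<parallel>\<close>.\<close>
    define r where "r = sqrt (hnorm ip g / hnorm ip h)"
    have r: "0 < r" "r\<^sup>2 = hnorm ip g / hnorm ip h" using pos by (auto simp: r_def)
    have hn: "(hnorm ip (scH (complex_of_real t) x))\<^sup>2 = t\<^sup>2 * (hnorm ip x)\<^sup>2" for t x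
      unfolding H.hnorm_square
      by (simp add: H.ip_scale_left H.ip_scale_right power2_eq_square)
    have "tensor v h g = tensor v (scH (complex_of_real r) h) (scH (complex_of_real (1 / r)) g)"
      using r(1) by (simp add: tensor_scale_left tensor_scale_right)
    then have "F (tensor v h g)
        = F (tensor v (scH (complex_of_real r) h) (scH (complex_of_real (1 / r)) g))"
      by (rule arg_cong)
    also have "\<dots> \<le> c * sqnorm 2 (pair (scH (complex_of_real (1 / r)) g) (scH (complex_of_real r) h))"
      unfolding tensor_eq_elem by (rule F_gauge[OF _ offdiag_Msa c]) simp
    also have "\<dots> = c * (((1 / r)\<^sup>2 * (hnorm ip g)\<^sup>2) + (r\<^sup>2 * (hnorm ip h)\<^sup>2))"
      by (simp only: sqnorm_pair hn)
    also have "((1 / r)\<^sup>2 * (hnorm ip g)\<^sup>2) + (r\<^sup>2 * (hnorm ip h)\<^sup>2) = 2 * (hnorm ip h * hnorm ip g)"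
      unfolding power_divide r(2) using pos by (simp add: field_simps power2_eq_square)
    finally show ?thesis by (simp add: b_def c_def mult.assoc)
  qed
  have b_abs: "\<bar>b v h g\<bar> \<le> (\<nu> 2 (offdiag v) + 1) * hnorm ip h * hnorm ip g" for v h g
  proof -
    have "b v (scH (- 1) h) g = - b v h g"
      using b_scale[of "- 1" v h g] by (simp add: b_def tensor_scale_left flip: H.scale_minus_left)
    moreover have "hnorm ip (scH (- 1) h) = hnorm ip h"
      by (simp add: hnorm_def H.ip_minus_left H.ip_minus_right)
    ultimately show ?thesis using b_le[of v h g] b_le[of v "scH (- 1) h" g] by simp
  qed
  have \<beta>_bound: "\<exists>K. \<forall>h g. cmod (\<beta> v h g) \<le> K * hnorm ip h * hnorm ip g" for v
  proof (intro exI allI)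
    fix h g
    have "cmod (\<beta> v h g) \<le> \<bar>b v h g\<bar> + \<bar>b (scV \<i> v) h g\<bar>"
      using cmod_le[of "\<beta> v h g"] by (simp add: \<beta>_def)
    also have "\<dots> \<le> ((\<nu> 2 (offdiag v) + 1) + (\<nu> 2 (offdiag (scV \<i> v)) + 1)) * hnorm ip h * hnorm ip g"
      using b_abs[of v h g] b_abs[of "scV \<i> v" h g] by (simp add: algebra_simps)
    finally show "cmod (\<beta> v h g)
        \<le> ((\<nu> 2 (offdiag v) + 1) + (\<nu> 2 (offdiag (scV \<i> v)) + 1)) * hnorm ip h * hnorm ip g" .
  qed
  have "\<exists>T. bounded_op scH ip T \<and> (\<forall>h g. ip (T h) g = \<beta> v h g)" for v
  proof -
    obtain K where "\<And>h g. cmod (\<beta> v h g) \<le> K * hnorm ip h * hnorm ip g" using \<beta>_bound by blast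
    then show ?thesis
      using bounded_sesquilinear_form_represented[of "\<beta> v" K, OF \<beta>_add_left \<beta>_scale_left \<beta>_add_right \<beta>_scale_right]
      by blast
  qed
  then obtain \<psi> where \<psi>_op: "\<And>v. bounded_op scH ip (\<psi> v)" and \<psi>: "\<And>v h g. ip (\<psi> v h) g = \<beta> v h g"
    by metis
  have "\<psi> x = \<phi> x" if x: "x \<in> S" for x
  proof
    fix h
    \<comment> \<open>The two off-diagonal terms are complex conjugates because
      \<open>\<phi>\<close> respects adjoints, so halving leaves one real part.\<close>
    have b_form: "b y h g = Re (ip (\<phi> y h) g)" if y: "y \<in> S" for y g
    proof -
      have "F (tensor y h g) = form 2 (offdiag y) (pair g h)"
        unfolding tensor_eq_elem using y S_st S_zero
        by (intro F_form offdiag_Msa) (auto simp: offdiag_def)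
      also have "\<dots> = Re (ip (\<phi> y h) g) + Re (ip (\<phi> (st y) g) h)"
        by (simp add: form_def offdiag_def pair_def numeral_2_eq_2 map_zero)
      also have "Re (ip (\<phi> (st y) g) h) = Re (ip (\<phi> y h) g)"
        unfolding map_adjoint[OF y] by (simp flip: H.ip_cnj[of "\<phi> y h" g])
      finally show ?thesis by (simp add: b_def)
    qed
    show "\<psi> x h = \<phi> x h"
    proof (rule H.ip_left_cancel)
      fix g
      show "ip (\<psi> x h) g = ip (\<phi> x h) g"
        by (simp add: \<psi> \<beta>_def b_form x S_scale map_scale H.ip_scale_left complex_eq_iff)
    qed
  qed
  moreover have "linear_into_BH scV UNIV scH ip \<psi>"
  proof -
    have "\<psi> (x + y) h = \<psi> x h + \<psi> y h" for x y h
      by (rule H.ip_left_cancel) (simp add: \<psi> H.ip_add_left \<beta>_add)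
    moreover have "\<psi> (scV c x) h = scH c (\<psi> x h)" for c x h
      by (rule H.ip_left_cancel) (simp add: \<psi> H.ip_scale_left \<beta>_scale)
    ultimately show ?thesis unfolding linear_into_BH_def using \<psi>_op by (simp add: fun_eq_iff)
  qed
  moreover have "cgc st \<nu> UNIV ip \<psi>"
    unfolding cgc_def
  proof (intro conjI allI ballI impI)
    fix x h g
    show "ip (\<psi> (st x) h) g = ip h (\<psi> x g)"
      unfolding H.ip_cnj[of "\<psi> x g" h, symmetric] \<psi> \<beta>_st ..
  next
    fix n A assume n: "1 \<le> n" and A: "A \<in> Msa st n"
    \<comment> \<open>By \<open>sum_tensor\<close> the real part of the quadratic form is
      \<open>F (elem n A \<xi>)\<close>, which the cone bounds from above.\<close>
    have le: "Re (\<Sum>i<n. \<Sum>j<n. ip (\<psi> (A i j) (\<xi> j)) (\<xi> i)) \<le> t * (\<Sum>i<n. Re (ip (\<xi> i) (\<xi> i)))"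
      if t: "0 < t" "\<nu> n A \<le> t" for t \<xi>
    proof -
      have "Re (\<Sum>i<n. \<Sum>j<n. ip (\<psi> (A i j) (\<xi> j)) (\<xi> i))
          = (\<Sum>i<n. \<Sum>j<n. F (tensor (A i j) (\<xi> j) (\<xi> i))) / 2"
        by (simp add: \<psi> \<beta>_def b_def sum_divide_distrib)
      also have "(\<Sum>i<n. \<Sum>j<n. F (tensor (A i j) (\<xi> j) (\<xi> i)))
          = F (\<Sum>i<n. \<Sum>j<n. tensor (A i j) (\<xi> j) (\<xi> i))"
        by (simp add: F_sum sa_tensors_sum tensor_in_sa_tensors)
      also have "\<dots> = 2 * F (elem n A \<xi>)"
        unfolding sum_tensor[OF A] using F_scale[OF elem_in_sa_tensors[OF n A]] .
      finally show ?thesis using F_gauge[OF n A t, of \<xi>] by (simp add: sqnorm_def)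
    qed
    show "dgauge ip n (\<lambda>i j. \<psi> (A i j)) \<le> \<nu> n A"
    \<comment> \<open>\<open>dgauge\<close> admits only \<open>t > 0\<close> while
      \<open>\<nu> n A\<close> may be 0, hence the slack \<open>\<delta>\<close>.\<close>
    proof (rule field_le_epsilon)
      fix \<delta> :: real assume "0 < \<delta>"
      then have "0 < \<nu> n A + \<delta>" "\<nu> n A \<le> \<nu> n A + \<delta>" using gauge_nonneg[OF n A] by auto
      then show "dgauge ip n (\<lambda>i j. \<psi> (A i j)) \<le> \<nu> n A + \<delta>"
        unfolding dgauge_def using le by (intro cInf_lower bdd_belowI[of _ 0]) auto
    qed
  qed
  ultimately show ?thesis by blast
qed

end

theorem theorem3p14:
  fixes scV :: "complex \<Rightarrow> 'v::ab_group_add \<Rightarrow> 'v" and st :: "'v \<Rightarrow> 'v"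
    and \<nu> :: "nat \<Rightarrow> (nat \<Rightarrow> nat \<Rightarrow> 'v) \<Rightarrow> real" and S :: "'v set"
    and scH :: "complex \<Rightarrow> 'h::ab_group_add \<Rightarrow> 'h" and ip :: "'h \<Rightarrow> 'h \<Rightarrow> complex"
    and \<phi> :: "'v \<Rightarrow> 'h \<Rightarrow> 'h"
  assumes "Linf_MOS scV st \<nu>"
    and "selfadjoint_subspace scV st S"
    and "hilbert_space scH ip"
    and "linear_into_BH scV S scH ip \<phi>"
    and "cgc st \<nu> S ip \<phi>"
  shows "\<exists>\<psi>. (\<forall>x\<in>S. \<psi> x = \<phi> x) \<and> linear_into_BH scV UNIV scH ip \<psi> \<and> cgc st \<nu> UNIV ip \<psi>"
proof -
  interpret gauge_contractive_map scV st \<nu> S scH ip \<phi> using assms by unfold_locales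
  show ?thesis by (rule gauge_contractive_extension)
qed

end
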